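(* Let $G$ and $H$ be single-conclusion sequent calculi such that $H$ extends $\mathbf{FL_e}$. (i) Suppose $H$ is an axiomatic extension of $G$ by semi-analytic rules (possibly also the modal rules $4$ or $4D$, in which case the left weakening rule for boxed formulas, $\Gamma\Rightarrow\Delta/\Gamma,\Box\phi\Rightarrow\Delta$, is admissible in $H$). Then if $G$ has $H$-interpolation (resp. $H$-feasible interpolation), so does $H$. (ii) Suppose $H$ is an axiomatic extension of $G$ by semi-analytic rules and context-sharing semi-analytic rules, and the left weakening rule $\Gamma\Rightarrow\Delta/\Gamma,\phi\Rightarrow\Delta$, the right weakening rule $\Gamma\Rightarrow\,/\,\Gamma\Rightarrow\phi$ and the context-sharing left implication rule $\Gamma\Rightarrow\phi\ \ \Gamma,\psi\Rightarrow\Delta/\Gamma,\phi\to\psi\Rightarrow\Delta$ are admissible in $H$. Then if $G$ has $H$-interpolation (resp. $H$-feasible interpolation), so does $H$.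
   Context: Formulas in a fixed propositional language containing $\wedge,\vee,\to,*,0,1,\top,\bot$ and possibly $\Box$; $V(\cdot)$: atoms (for meta-formulas also formula variables). Single-conclusion sequents $\Gamma\Rightarrow\Delta$ ($|\Delta|\le1$, finite multisets). Rules: schemes over meta-formulas and meta-multiset variables. $H$ extends $\mathbf{FL_e}$: every $\mathbf{FL_e}$-provable sequent is $H$-provable, where $\mathbf{FL_e}$ has axioms $\phi\Rightarrow\phi$, $\Rightarrow1$, $0\Rightarrow$, $\Gamma\Rightarrow\top$, $\Gamma,\bot\Rightarrow\Delta$ and the standard single-conclusion rules for $1,0,\wedge,\vee,*$ (multiplicative $R*$) and $\to$ (multiplicative $L\to$: $\Gamma\Rightarrow\phi\ \ \Sigma,\psi\Rightarrow\Lambda/\Gamma,\Sigma,\phi\to\psi\Rightarrow\Lambda$). $H$ is an axiomatic extension of $G$ by rules $R$ if $H$ consists of all $G$-provable sequents as axioms plus the rules $R$. A rule is admissible if its conclusion is provable whenever its premises are. Semi-analytic rules: left: premises $\Pi_j,\bar\psi_{js}\Rightarrow\bar\theta_{js}$ and $\Gamma_i,\bar\phi_{ir}\Rightarrow\Delta_i$, conclusion $\Pi_1,\dots,\Pi_m,\Gamma_1,\dots,\Gamma_n,\phi\Rightarrow\Delta_1,\dots,\Delta_n$, with $\Pi_j,\Gamma_i,\Delta_i$ meta-multiset variables and all variables of $\bar\phi_{ir},\bar\psi_{js},\bar\theta_{js}$ in $V(\phi)$; right: premises $\Gamma_i,\bar\phi_{ir}\Rightarrow\bar\psi_{ir}$,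 conclusion $\Gamma_1,\dots,\Gamma_n\Rightarrow\phi$, variables in $V(\phi)$; modal: $K$: $\Gamma\Rightarrow\phi/\Box\Gamma\Rightarrow\Box\phi$, $D$: $\Gamma\Rightarrow/\Box\Gamma\Rightarrow$ (only with $K$), $RS4$: $\Box\Gamma\Rightarrow\phi/\Box\Gamma\Rightarrow\Box\phi$ (only with $LS4$: $\Gamma,\phi\Rightarrow\Delta/\Gamma,\Box\phi\Rightarrow\Delta$), $\Gamma$ a meta-multiset variable, $\Box\emptyset=\emptyset$. Rule $4$: $\Box\Gamma,\Gamma\Rightarrow\phi/\Box\Gamma\Rightarrow\Box\phi$; rule $4D$: $\Box\Gamma,\Gamma\Rightarrow/\Box\Gamma\Rightarrow$ (only with $4$). Context-sharing semi-analytic: premises $\Gamma_i,\bar\psi_{is}\Rightarrow\bar\theta_{is}$ and $\Gamma_i,\bar\phi_{ir}\Rightarrow\Delta_i$, conclusion $\Gamma_1,\dots,\Gamma_n,\phi\Rightarrow\Delta_1,\dots,\Delta_n$, variables in $V(\phi)$. $G$ has $H$-interpolation if whenever $\Sigma,\Lambda\Rightarrow\Delta$ has a tree-like $G$-proof $\pi$ there is $C$ with $H\vdash\Sigma\Rightarrow C$, $H\vdash\Lambda,C\Rightarrow\Delta$, $V(C)\subseteq V(\Sigma)\cap V(\Lambda\cup\Delta)$; $H$-feasible interpolation additionally requires $|C|\le|\pi|^{O(1)}$ ($|\cdot|$ = encoding length).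
   Formalization: "H extends FL_e" is taken to mean that all axioms and rules of FL_e are admissible in H (with only FL_e-theorems provable in H, the claim fails), and the length of an H-proof counts the G-proofs of the G-provable sequents used as axioms. *)

theory Defs
  imports Main "HOL-Library.Multiset" "HOL-Library.Discrete_Functions"
begin

section \<open>Formulas\<close>

text \<open>
  The language is fixed by a set \<open>L\<close> of connectives beyond the basic ones
  \<open>\<and>, \<or>, \<rightarrow>, *, 0, 1, \<top>, \<bottom>\<close>. Thus \<open>BoxC \<in> L\<close> expresses that the language contains \<open>\<box>\<close>;
  \<open>ExtC c n\<close> is a further \<open>n\<close>-ary connective.
\<close>

datatype 'c conn = BoxC | ExtC 'c nat

fun arity :: "'c conn \<Rightarrow> nat" where
  "arity BoxC = 1"
| "arity (ExtC c n) = n"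

text \<open>The set function \<open>V\<close> of the datatype yields the set of leaves occurring in a formula.\<close>

datatype (V: 'a, dead 'c) fm =
    Var 'a
  | One | Zero | Top | Bot
  | And "('a, 'c) fm" "('a, 'c) fm"
  | Or "('a, 'c) fm" "('a, 'c) fm"
  | Fus "('a, 'c) fm" "('a, 'c) fm"
  | Imp "('a, 'c) fm" "('a, 'c) fm"
  | Op "'c conn" "('a, 'c) fm list"

abbreviation Box :: "('a, 'c) fm \<Rightarrow> ('a, 'c) fm" where
  "Box \<phi> \<equiv> Op BoxC [\<phi>]"

fun in_lang :: "'c conn set \<Rightarrow> ('a, 'c) fm \<Rightarrow> bool" where
  "in_lang L (Var a) = True"
| "in_lang L One = True"
| "in_lang L Zero = True"
| "in_lang L Top = True"
| "in_lang L Bot = True"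
| "in_lang L (And \<phi> \<psi>) = (in_lang L \<phi> \<and> in_lang L \<psi>)"
| "in_lang L (Or \<phi> \<psi>) = (in_lang L \<phi> \<and> in_lang L \<psi>)"
| "in_lang L (Fus \<phi> \<psi>) = (in_lang L \<phi> \<and> in_lang L \<psi>)"
| "in_lang L (Imp \<phi> \<psi>) = (in_lang L \<phi> \<and> in_lang L \<psi>)"
| "in_lang L (Op k \<phi>s) = (k \<in> L \<and> length \<phi>s = arity k \<and> (\<forall>\<phi>\<in>set \<phi>s. in_lang L \<phi>))"

text \<open>The leaves of a formula are atoms, those of a meta-formula are atoms or formula variables.\<close>

type_synonym 'c form = "(nat, 'c) fm"

datatype mleaf = MAtom nat | MForm nat

type_synonym 'c mform = "(mleaf, 'c) fm"

fun inst_form :: "(nat \<Rightarrow> 'c form) \<Rightarrow> 'c mform \<Rightarrow> 'c form" where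
  "inst_form \<sigma> (Var (MAtom p)) = Var p"
| "inst_form \<sigma> (Var (MForm n)) = \<sigma> n"
| "inst_form \<sigma> One = One"
| "inst_form \<sigma> Zero = Zero"
| "inst_form \<sigma> Top = Top"
| "inst_form \<sigma> Bot = Bot"
| "inst_form \<sigma> (And \<phi> \<psi>) = And (inst_form \<sigma> \<phi>) (inst_form \<sigma> \<psi>)"
| "inst_form \<sigma> (Or \<phi> \<psi>) = Or (inst_form \<sigma> \<phi>) (inst_form \<sigma> \<psi>)"
| "inst_form \<sigma> (Fus \<phi> \<psi>) = Fus (inst_form \<sigma> \<phi>) (inst_form \<sigma> \<psi>)"
| "inst_form \<sigma> (Imp \<phi> \<psi>) = Imp (inst_form \<sigma> \<phi>) (inst_form \<sigma> \<psi>)"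
| "inst_form \<sigma> (Op k \<phi>s) = Op k (map (inst_form \<sigma>) \<phi>s)"

definition Vs :: "('a, 'c) fm multiset \<Rightarrow> 'a set" where
  "Vs M = (\<Union>\<phi>\<in>set_mset M. V \<phi>)"


section \<open>Sequents and rules\<close>

datatype 'x seq = Seq (ante: "'x multiset") (succ: "'x multiset")  (infix "\<Rightarrow>\<^sub>s" 45)

type_synonym 'c sequent = "'c form seq"

text \<open>
  A rule is a scheme over meta-formulas, meta-multiset variables \<open>\<Gamma>\<close> (\<open>Ctx\<close>) and
  boxed meta-multiset variables \<open>\<box>\<Gamma>\<close> (\<open>BoxCtx\<close>).
\<close>

datatype 'c item = MF "'c mform" | Ctx nat | BoxCtx nat

datatype 'c rule = Rule (prems: "'c item seq multiset") (concl: "'c item seq")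

fun inst_item :: "(nat \<Rightarrow> 'c form) \<Rightarrow> (nat \<Rightarrow> 'c form multiset) \<Rightarrow> 'c item \<Rightarrow> 'c form multiset"
  where
  "inst_item \<sigma> \<mu> (MF \<phi>) = {#inst_form \<sigma> \<phi>#}"
| "inst_item \<sigma> \<mu> (Ctx n) = \<mu> n"
| "inst_item \<sigma> \<mu> (BoxCtx n) = image_mset Box (\<mu> n)"

definition inst_seq ::
  "(nat \<Rightarrow> 'c form) \<Rightarrow> (nat \<Rightarrow> 'c form multiset) \<Rightarrow> 'c item seq \<Rightarrow> 'c sequent" where
  "inst_seq \<sigma> \<mu> S =
     (\<Sum>\<^sub># (image_mset (inst_item \<sigma> \<mu>) (ante S)) \<Rightarrow>\<^sub>s \<Sum>\<^sub># (image_mset (inst_item \<sigma> \<mu>) (succ S)))"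

definition single_conclusion :: "'x seq \<Rightarrow> bool" where
  "single_conclusion S \<longleftrightarrow> size (succ S) \<le> 1"

text \<open>
  All calculi are single-conclusion: only those instances of a scheme count in which every premise
  and the conclusion have at most one formula on the right.
\<close>

definition rule_instance ::
  "'c conn set \<Rightarrow> 'c rule \<Rightarrow> 'c sequent multiset \<Rightarrow> 'c sequent \<Rightarrow> bool" where
  "rule_instance L r Ps S \<longleftrightarrow>
     (\<exists>\<sigma> \<mu>. (\<forall>n. in_lang L (\<sigma> n)) \<and> (\<forall>n. \<forall>\<phi>\<in>#\<mu> n. in_lang L \<phi>) \<and>
        Ps = image_mset (inst_seq \<sigma> \<mu>) (prems r) \<and> S = inst_seq \<sigma> \<mu> (concl r)) \<and>
     (\<forall>P\<in>#Ps. single_conclusion P) \<and> single_conclusion S"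

fun item_in_lang :: "'c conn set \<Rightarrow> 'c item \<Rightarrow> bool" where
  "item_in_lang L (MF \<phi>) = in_lang L \<phi>"
| "item_in_lang L (Ctx n) = True"
| "item_in_lang L (BoxCtx n) = (BoxC \<in> L)"

definition rule_in_lang :: "'c conn set \<Rightarrow> 'c rule \<Rightarrow> bool" where
  "rule_in_lang L r \<longleftrightarrow>
     (\<forall>S\<in>#add_mset (concl r) (prems r). \<forall>x\<in>#ante S + succ S. item_in_lang L x)"


section \<open>Calculi, tree-like proofs, provability\<close>

text \<open>\<open>AxExt G R\<close> is the axiomatic extension of \<open>G\<close> by the rules \<open>R\<close>.\<close>

datatype 'c calculus = Calc "'c rule set" | AxExt "'c calculus" "'c rule set"

fun calculus_in_lang :: "'c conn set \<Rightarrow> 'c calculus \<Rightarrow> bool" where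
  "calculus_in_lang L (Calc R) = (\<forall>r\<in>R. rule_in_lang L r)"
| "calculus_in_lang L (AxExt G R) = (calculus_in_lang L G \<and> (\<forall>r\<in>R. rule_in_lang L r))"

datatype 'c ptree = Node (root: "'c sequent") "'c ptree list"

inductive_set derivs :: "'c conn set \<Rightarrow> 'c ptree set \<Rightarrow> 'c rule set \<Rightarrow> 'c ptree set"
  for L :: "'c conn set" and A :: "'c ptree set" and R :: "'c rule set" where
  base: "t \<in> A \<Longrightarrow> t \<in> derivs L A R"
| step: "\<lbrakk>r \<in> R; \<forall>t\<in>set ts. t \<in> derivs L A R; rule_instance L r (mset (map root ts)) S\<rbrakk>
    \<Longrightarrow> Node S ts \<in> derivs L A R"

text \<open>
  In a proof in \<open>AxExt G R\<close> an axiom, i.e. a \<open>G\<close>-provable sequent, is justified by a \<open>G\<close>-proof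
  of it, and this \<open>G\<close>-proof is part of the proof. For provability this makes no difference
  (lemma \<open>provable_AxExt\<close> below), but it is what makes the length of a proof in \<open>AxExt G R\<close>
  account for the length of the \<open>G\<close>-proofs it rests on.
\<close>

primrec proofs :: "'c conn set \<Rightarrow> 'c calculus \<Rightarrow> 'c ptree set" where
  "proofs L (Calc R) = derivs L {} R"
| "proofs L (AxExt G R) = derivs L (proofs L G) R"

definition provable :: "'c conn set \<Rightarrow> 'c calculus \<Rightarrow> 'c sequent \<Rightarrow> bool" where
  "provable L G S \<longleftrightarrow> (\<exists>\<pi>\<in>proofs L G. root \<pi> = S)"

inductive derivable :: "'c conn set \<Rightarrow> 'c sequent set \<Rightarrow> 'c rule set \<Rightarrow> 'c sequent \<Rightarrow> bool"
  for L :: "'c conn set" and X :: "'c sequent set" and R :: "'c rule set" where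
  ax: "S \<in> X \<Longrightarrow> derivable L X R S"
| rule: "\<lbrakk>r \<in> R; rule_instance L r Ps S; \<forall>P\<in>#Ps. derivable L X R P\<rbrakk> \<Longrightarrow> derivable L X R S"

lemma derivs_iff_derivable:
  "(\<exists>\<pi>\<in>derivs L A R. root \<pi> = S) \<longleftrightarrow> derivable L (root ` A) R S"
proof
  assume "\<exists>\<pi>\<in>derivs L A R. root \<pi> = S"
  then obtain \<pi> where "\<pi> \<in> derivs L A R" "root \<pi> = S" by blast
  then show "derivable L (root ` A) R S"
  proof (induction arbitrary: S rule: derivs.induct)
    case (base t)
    then show ?case by (auto intro: derivable.ax)
  next
    case (step r ts S')
    have "\<forall>P\<in>#mset (map root ts). derivable L (root ` A) R P"
      using step.IH by auto
    then show ?case using step.hyps step.prems derivable.rule by (metis ptree.sel(1))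
  qed
next
  assume "derivable L (root ` A) R S"
  then show "\<exists>\<pi>\<in>derivs L A R. root \<pi> = S"
  proof induction
    case (ax S)
    then show ?case by (auto intro: derivs.base)
  next
    case (rule r Ps S)
    obtain Ss where Ss: "mset Ss = Ps" using ex_mset by blast
    have "\<forall>P\<in>set Ss. \<exists>\<pi>. \<pi> \<in> derivs L A R \<and> root \<pi> = P"
      using rule.IH Ss by auto
    then obtain f where f: "\<forall>P\<in>set Ss. f P \<in> derivs L A R \<and> root (f P) = P" by metis
    have "map root (map f Ss) = Ss" using f by (simp add: map_idI)
    then have "Node S (map f Ss) \<in> derivs L A R"
      using rule.hyps f Ss by (intro derivs.step[of r]) auto
    then show ?case by force
  qed
qed

lemma provable_Calc: "provable L (Calc R) S \<longleftrightarrow> derivable L {} R S"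
  using derivs_iff_derivable[of L "{}" R S] by (simp add: provable_def)

lemma provable_AxExt:
  "provable L (AxExt G R) S \<longleftrightarrow> derivable L {S. provable L G S} R S"
proof -
  have "{S. provable L G S} = root ` proofs L G" by (auto simp: provable_def)
  then show ?thesis using derivs_iff_derivable[of L "proofs L G" R S] by (simp add: provable_def)
qed

definition admissible :: "'c conn set \<Rightarrow> 'c calculus \<Rightarrow> 'c rule \<Rightarrow> bool" where
  "admissible L H r \<longleftrightarrow>
     (\<forall>Ps S. rule_instance L r Ps S \<longrightarrow> (\<forall>P\<in>#Ps. provable L H P) \<longrightarrow> provable L H S)"


section \<open>The calculus \<open>FL\<^sub>e\<close>\<close>

text \<open>Names for the schematic letters; distinct numbers denote distinct variables.\<close>

abbreviation "m\<phi> \<equiv> Var (MForm 0)"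
abbreviation "m\<psi> \<equiv> Var (MForm 1)"
abbreviation "c\<Gamma> \<equiv> Ctx 0"
abbreviation "c\<Sigma> \<equiv> Ctx 1"
abbreviation "c\<Delta> \<equiv> Ctx 2"

definition FLe_rules :: "'c rule set" where
  "FLe_rules = {
     \<comment> \<open>axioms\<close>
     Rule {#} ({#MF m\<phi>#} \<Rightarrow>\<^sub>s {#MF m\<phi>#}),
     Rule {#} ({#} \<Rightarrow>\<^sub>s {#MF One#}),
     Rule {#} ({#MF Zero#} \<Rightarrow>\<^sub>s {#}),
     Rule {#} ({#c\<Gamma>#} \<Rightarrow>\<^sub>s {#MF Top#}),
     Rule {#} ({#c\<Gamma>, MF Bot#} \<Rightarrow>\<^sub>s {#c\<Delta>#}),
     \<comment> \<open>\<open>1\<close> and \<open>0\<close>\<close>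
     Rule {#{#c\<Gamma>#} \<Rightarrow>\<^sub>s {#c\<Delta>#}#} ({#c\<Gamma>, MF One#} \<Rightarrow>\<^sub>s {#c\<Delta>#}),
     Rule {#{#c\<Gamma>#} \<Rightarrow>\<^sub>s {#}#} ({#c\<Gamma>#} \<Rightarrow>\<^sub>s {#MF Zero#}),
     \<comment> \<open>\<open>\<and>\<close>\<close>
     Rule {#{#c\<Gamma>, MF m\<phi>#} \<Rightarrow>\<^sub>s {#c\<Delta>#}#} ({#c\<Gamma>, MF (And m\<phi> m\<psi>)#} \<Rightarrow>\<^sub>s {#c\<Delta>#}),
     Rule {#{#c\<Gamma>, MF m\<psi>#} \<Rightarrow>\<^sub>s {#c\<Delta>#}#} ({#c\<Gamma>, MF (And m\<phi> m\<psi>)#} \<Rightarrow>\<^sub>s {#c\<Delta>#}),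
     Rule {#{#c\<Gamma>#} \<Rightarrow>\<^sub>s {#MF m\<phi>#}, {#c\<Gamma>#} \<Rightarrow>\<^sub>s {#MF m\<psi>#}#} ({#c\<Gamma>#} \<Rightarrow>\<^sub>s {#MF (And m\<phi> m\<psi>)#}),
     \<comment> \<open>\<open>\<or>\<close>\<close>
     Rule {#{#c\<Gamma>, MF m\<phi>#} \<Rightarrow>\<^sub>s {#c\<Delta>#}, {#c\<Gamma>, MF m\<psi>#} \<Rightarrow>\<^sub>s {#c\<Delta>#}#}
       ({#c\<Gamma>, MF (Or m\<phi> m\<psi>)#} \<Rightarrow>\<^sub>s {#c\<Delta>#}),
     Rule {#{#c\<Gamma>#} \<Rightarrow>\<^sub>s {#MF m\<phi>#}#} ({#c\<Gamma>#} \<Rightarrow>\<^sub>s {#MF (Or m\<phi> m\<psi>)#}),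
     Rule {#{#c\<Gamma>#} \<Rightarrow>\<^sub>s {#MF m\<psi>#}#} ({#c\<Gamma>#} \<Rightarrow>\<^sub>s {#MF (Or m\<phi> m\<psi>)#}),
     \<comment> \<open>\<open>*\<close>\<close>
     Rule {#{#c\<Gamma>, MF m\<phi>, MF m\<psi>#} \<Rightarrow>\<^sub>s {#c\<Delta>#}#} ({#c\<Gamma>, MF (Fus m\<phi> m\<psi>)#} \<Rightarrow>\<^sub>s {#c\<Delta>#}),
     Rule {#{#c\<Gamma>#} \<Rightarrow>\<^sub>s {#MF m\<phi>#}, {#c\<Sigma>#} \<Rightarrow>\<^sub>s {#MF m\<psi>#}#}
       ({#c\<Gamma>, c\<Sigma>#} \<Rightarrow>\<^sub>s {#MF (Fus m\<phi> m\<psi>)#}),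
     \<comment> \<open>\<open>\<rightarrow>\<close>\<close>
     Rule {#{#c\<Gamma>#} \<Rightarrow>\<^sub>s {#MF m\<phi>#}, {#c\<Sigma>, MF m\<psi>#} \<Rightarrow>\<^sub>s {#c\<Delta>#}#}
       ({#c\<Gamma>, c\<Sigma>, MF (Imp m\<phi> m\<psi>)#} \<Rightarrow>\<^sub>s {#c\<Delta>#}),
     Rule {#{#c\<Gamma>, MF m\<phi>#} \<Rightarrow>\<^sub>s {#MF m\<psi>#}#} ({#c\<Gamma>#} \<Rightarrow>\<^sub>s {#MF (Imp m\<phi> m\<psi>)#})}"

definition FLe :: "'c calculus" where
  "FLe = Calc FLe_rules"

text \<open>
  \<open>H\<close> extends \<open>FL\<^sub>e\<close>: whatever \<open>FL\<^sub>e\<close> proves, also from sequents already provable in \<open>H\<close>, is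
  provable in \<open>H\<close>; that is, the axioms and rules of \<open>FL\<^sub>e\<close> are admissible in \<open>H\<close>. Merely asking
  that the theorems of \<open>FL\<^sub>e\<close> be provable in \<open>H\<close> is too weak for interpolation to transfer. Let
  \<open>G\<close> be \<open>FL\<^sub>e\<close> and let \<open>R\<close> consist of the two left semi-analytic rules
  \<open>\<Gamma>,\<phi> \<Rightarrow> \<Delta> / \<Gamma>,\<phi>*\<psi> \<Rightarrow> \<Delta>\<close> and \<open>L\<or>\<close>. Then
  \<open>a*b, c*d, u\<or>v \<Rightarrow> ((a*(c*d))*u) \<or> (((a*b)*c)*v)\<close> is provable in \<open>AxExt G R\<close> but has no
  interpolant there for the partition \<open>a*b, c*d | u\<or>v\<close>: the obvious candidate
  \<open>(a*(c*d)) \<and> ((a*b)*c)\<close> fails because \<open>R\<and>\<close> is not admissible.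
\<close>

definition extends_FLe :: "'c conn set \<Rightarrow> 'c calculus \<Rightarrow> bool" where
  "extends_FLe L H \<longleftrightarrow> (\<forall>r\<in>FLe_rules. admissible L H r)"

lemma extends_FLe_iff:
  "extends_FLe L H \<longleftrightarrow> (\<forall>S. provable L (AxExt H FLe_rules) S \<longrightarrow> provable L H S)"
proof
  assume ext: "extends_FLe L H"
  have "provable L H S" if "derivable L {S. provable L H S} FLe_rules S" for S
    using that ext by induction (auto simp: extends_FLe_def admissible_def)
  then show "\<forall>S. provable L (AxExt H FLe_rules) S \<longrightarrow> provable L H S"
    by (simp add: provable_AxExt)
next
  assume *: "\<forall>S. provable L (AxExt H FLe_rules) S \<longrightarrow> provable L H S"
  show "extends_FLe L H"
    unfolding extends_FLe_def admissible_def
    using * by (auto simp: provable_AxExt intro: derivable.intros)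
qed

lemma extends_FLe_provable:
  assumes "extends_FLe L H" and "provable L FLe S"
  shows "provable L H S"
proof -
  have "derivable L {} FLe_rules S"
    using assms(2) by (simp add: FLe_def provable_Calc)
  then show ?thesis
    using assms(1) by induction (auto simp: extends_FLe_def admissible_def)
qed


section \<open>Semi-analytic rules\<close>

text \<open>
  In the following definitions \<open>Ps\<close> lists, for every \<open>j\<close>, the variable \<open>\<Pi>\<^sub>j\<close> together with
  the pairs of multisets \<open>\<psi>\<^sub>j\<^sub>s, \<theta>\<^sub>j\<^sub>s\<close>; \<open>Gs\<close> lists, for every \<open>i\<close>, the variables
  \<open>\<Gamma>\<^sub>i\<close>, \<open>\<Delta>\<^sub>i\<close> together with the multisets \<open>\<phi>\<^sub>i\<^sub>r\<close>, and similarly for the other kinds of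
  rules. All the lists may be empty.
\<close>

definition left_semi_analytic :: "'c rule \<Rightarrow> bool" where
  "left_semi_analytic r \<longleftrightarrow>
    (\<exists>(Ps :: (nat \<times> ('c mform multiset \<times> 'c mform multiset) list) list)
      (Gs :: (nat \<times> nat \<times> 'c mform multiset list) list) \<phi>.
      distinct (map fst Ps @ map fst Gs @ map (fst \<circ> snd) Gs) \<and>
      (\<forall>(\<Pi>, prs)\<in>set Ps. \<forall>(\<psi>s, \<theta>s)\<in>set prs. Vs \<psi>s \<union> Vs \<theta>s \<subseteq> V \<phi>) \<and>
      (\<forall>(\<Gamma>, \<Delta>, \<phi>ss)\<in>set Gs. \<forall>\<phi>s\<in>set \<phi>ss. Vs \<phi>s \<subseteq> V \<phi>) \<and>
      prems r =
        mset (concat (map (\<lambda>(\<Pi>, prs). map (\<lambda>(\<psi>s, \<theta>s).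
          add_mset (Ctx \<Pi>) (image_mset MF \<psi>s) \<Rightarrow>\<^sub>s image_mset MF \<theta>s) prs) Ps)) +
        mset (concat (map (\<lambda>(\<Gamma>, \<Delta>, \<phi>ss). map (\<lambda>\<phi>s.
          add_mset (Ctx \<Gamma>) (image_mset MF \<phi>s) \<Rightarrow>\<^sub>s {#Ctx \<Delta>#}) \<phi>ss) Gs)) \<and>
      concl r =
        (mset (map (\<lambda>(\<Pi>, prs). Ctx \<Pi>) Ps) + mset (map (\<lambda>(\<Gamma>, \<Delta>, \<phi>ss). Ctx \<Gamma>) Gs) + {#MF \<phi>#}
         \<Rightarrow>\<^sub>s mset (map (\<lambda>(\<Gamma>, \<Delta>, \<phi>ss). Ctx \<Delta>) Gs)))"

definition right_semi_analytic :: "'c rule \<Rightarrow> bool" where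
  "right_semi_analytic r \<longleftrightarrow>
    (\<exists>(Gs :: (nat \<times> ('c mform multiset \<times> 'c mform multiset) list) list) \<phi>.
      distinct (map fst Gs) \<and>
      (\<forall>(\<Gamma>, prs)\<in>set Gs. \<forall>(\<phi>s, \<psi>s)\<in>set prs. Vs \<phi>s \<union> Vs \<psi>s \<subseteq> V \<phi>) \<and>
      prems r =
        mset (concat (map (\<lambda>(\<Gamma>, prs). map (\<lambda>(\<phi>s, \<psi>s).
          add_mset (Ctx \<Gamma>) (image_mset MF \<phi>s) \<Rightarrow>\<^sub>s image_mset MF \<psi>s) prs) Gs)) \<and>
      concl r = (mset (map (\<lambda>(\<Gamma>, prs). Ctx \<Gamma>) Gs) \<Rightarrow>\<^sub>s {#MF \<phi>#}))"

definition context_sharing_semi_analytic :: "'c rule \<Rightarrow> bool" where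
  "context_sharing_semi_analytic r \<longleftrightarrow>
    (\<exists>(Gs :: (nat \<times> nat \<times> ('c mform multiset \<times> 'c mform multiset) list \<times>
        'c mform multiset list) list) \<phi>.
      distinct (map fst Gs @ map (fst \<circ> snd) Gs) \<and>
      (\<forall>(\<Gamma>, \<Delta>, prs, \<phi>ss)\<in>set Gs.
        (\<forall>(\<psi>s, \<theta>s)\<in>set prs. Vs \<psi>s \<union> Vs \<theta>s \<subseteq> V \<phi>) \<and> (\<forall>\<phi>s\<in>set \<phi>ss. Vs \<phi>s \<subseteq> V \<phi>)) \<and>
      prems r =
        mset (concat (map (\<lambda>(\<Gamma>, \<Delta>, prs, \<phi>ss). map (\<lambda>(\<psi>s, \<theta>s).
          add_mset (Ctx \<Gamma>) (image_mset MF \<psi>s) \<Rightarrow>\<^sub>s image_mset MF \<theta>s) prs) Gs)) +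
        mset (concat (map (\<lambda>(\<Gamma>, \<Delta>, prs, \<phi>ss). map (\<lambda>\<phi>s.
          add_mset (Ctx \<Gamma>) (image_mset MF \<phi>s) \<Rightarrow>\<^sub>s {#Ctx \<Delta>#}) \<phi>ss) Gs)) \<and>
      concl r =
        (mset (map (\<lambda>(\<Gamma>, \<Delta>, prs, \<phi>ss). Ctx \<Gamma>) Gs) + {#MF \<phi>#}
         \<Rightarrow>\<^sub>s mset (map (\<lambda>(\<Gamma>, \<Delta>, prs, \<phi>ss). Ctx \<Delta>) Gs)))"

text \<open>The modal rules, up to the choice of the schematic letters.\<close>

definition rule_K :: "'c rule \<Rightarrow> bool" where
  "rule_K r \<longleftrightarrow> (\<exists>\<Gamma> n. r = Rule {#{#Ctx \<Gamma>#} \<Rightarrow>\<^sub>s {#MF (Var (MForm n))#}#}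
     ({#BoxCtx \<Gamma>#} \<Rightarrow>\<^sub>s {#MF (Box (Var (MForm n)))#}))"

definition rule_D :: "'c rule \<Rightarrow> bool" where
  "rule_D r \<longleftrightarrow> (\<exists>\<Gamma>. r = Rule {#{#Ctx \<Gamma>#} \<Rightarrow>\<^sub>s {#}#} ({#BoxCtx \<Gamma>#} \<Rightarrow>\<^sub>s {#}))"

definition rule_RS4 :: "'c rule \<Rightarrow> bool" where
  "rule_RS4 r \<longleftrightarrow> (\<exists>\<Gamma> n. r = Rule {#{#BoxCtx \<Gamma>#} \<Rightarrow>\<^sub>s {#MF (Var (MForm n))#}#}
     ({#BoxCtx \<Gamma>#} \<Rightarrow>\<^sub>s {#MF (Box (Var (MForm n)))#}))"

definition rule_LS4 :: "'c rule \<Rightarrow> bool" where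
  "rule_LS4 r \<longleftrightarrow> (\<exists>\<Gamma> \<Delta> n. \<Gamma> \<noteq> \<Delta> \<and>
     r = Rule {#{#Ctx \<Gamma>, MF (Var (MForm n))#} \<Rightarrow>\<^sub>s {#Ctx \<Delta>#}#}
       ({#Ctx \<Gamma>, MF (Box (Var (MForm n)))#} \<Rightarrow>\<^sub>s {#Ctx \<Delta>#}))"

definition rule_4 :: "'c rule \<Rightarrow> bool" where
  "rule_4 r \<longleftrightarrow> (\<exists>\<Gamma> n. r = Rule {#{#BoxCtx \<Gamma>, Ctx \<Gamma>#} \<Rightarrow>\<^sub>s {#MF (Var (MForm n))#}#}
     ({#BoxCtx \<Gamma>#} \<Rightarrow>\<^sub>s {#MF (Box (Var (MForm n)))#}))"

definition rule_4D :: "'c rule \<Rightarrow> bool" where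
  "rule_4D r \<longleftrightarrow> (\<exists>\<Gamma>. r = Rule {#{#BoxCtx \<Gamma>, Ctx \<Gamma>#} \<Rightarrow>\<^sub>s {#}#} ({#BoxCtx \<Gamma>#} \<Rightarrow>\<^sub>s {#}))"

text \<open>\<open>LS4\<close> needs no disjunct of its own, being a left semi-analytic rule.\<close>

definition semi_analytic :: "'c rule \<Rightarrow> bool" where
  "semi_analytic r \<longleftrightarrow> left_semi_analytic r \<or> right_semi_analytic r \<or>
     rule_K r \<or> rule_D r \<or> rule_RS4 r"

text \<open>The side conditions ``only with'' on the presence of modal rules in a set of rules.\<close>

definition modal_compatible :: "'c rule set \<Rightarrow> bool" where
  "modal_compatible R \<longleftrightarrow>
     ((\<exists>r\<in>R. rule_D r) \<longrightarrow> (\<exists>r\<in>R. rule_K r)) \<and>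
     ((\<exists>r\<in>R. rule_RS4 r) \<longrightarrow> (\<exists>r\<in>R. rule_LS4 r)) \<and>
     ((\<exists>r\<in>R. rule_4D r) \<longrightarrow> (\<exists>r\<in>R. rule_4 r))"

definition left_weakening_boxed :: "'c rule" where
  "left_weakening_boxed = Rule {#{#c\<Gamma>#} \<Rightarrow>\<^sub>s {#c\<Delta>#}#} ({#c\<Gamma>, MF (Box m\<phi>)#} \<Rightarrow>\<^sub>s {#c\<Delta>#})"

definition left_weakening :: "'c rule" where
  "left_weakening = Rule {#{#c\<Gamma>#} \<Rightarrow>\<^sub>s {#c\<Delta>#}#} ({#c\<Gamma>, MF m\<phi>#} \<Rightarrow>\<^sub>s {#c\<Delta>#})"

definition right_weakening :: "'c rule" where
  "right_weakening = Rule {#{#c\<Gamma>#} \<Rightarrow>\<^sub>s {#}#} ({#c\<Gamma>#} \<Rightarrow>\<^sub>s {#MF m\<phi>#})"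

definition context_sharing_left_imp :: "'c rule" where
  "context_sharing_left_imp =
     Rule {#{#c\<Gamma>#} \<Rightarrow>\<^sub>s {#MF m\<phi>#}, {#c\<Gamma>, MF m\<psi>#} \<Rightarrow>\<^sub>s {#c\<Delta>#}#}
       ({#c\<Gamma>, MF (Imp m\<phi> m\<psi>)#} \<Rightarrow>\<^sub>s {#c\<Delta>#})"


section \<open>Encoding length and interpolation\<close>

text \<open>
  Formulas are written in prefix notation, the index of an atom in binary; the formulas of a sequent
  are terminated by a separator, and a proof is written as a term over its sequents.
\<close>

fun form_length :: "'c form \<Rightarrow> nat" where
  "form_length (Var p) = Suc (Suc (floor_log p))"
| "form_length One = 1"
| "form_length Zero = 1"
| "form_length Top = 1"
| "form_length Bot = 1"
| "form_length (And \<phi> \<psi>) = Suc (form_length \<phi> + form_length \<psi>)"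
| "form_length (Or \<phi> \<psi>) = Suc (form_length \<phi> + form_length \<psi>)"
| "form_length (Fus \<phi> \<psi>) = Suc (form_length \<phi> + form_length \<psi>)"
| "form_length (Imp \<phi> \<psi>) = Suc (form_length \<phi> + form_length \<psi>)"
| "form_length (Op k \<phi>s) = Suc (sum_list (map form_length \<phi>s))"

definition seq_length :: "'c sequent \<Rightarrow> nat" where
  "seq_length S = Suc (\<Sum>\<phi>\<in>#ante S + succ S. Suc (form_length \<phi>))"

fun proof_length :: "'c ptree \<Rightarrow> nat" where
  "proof_length (Node S ts) = Suc (seq_length S + sum_list (map proof_length ts))"

definition interpolant ::
  "'c conn set \<Rightarrow> 'c calculus \<Rightarrow> 'c form multiset \<Rightarrow> 'c form multiset \<Rightarrow> 'c form multiset \<Rightarrow>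
   'c form \<Rightarrow> bool" where
  "interpolant L H \<Sigma> \<Lambda> \<Delta> C \<longleftrightarrow>
     in_lang L C \<and> provable L H (\<Sigma> \<Rightarrow>\<^sub>s {#C#}) \<and> provable L H (\<Lambda> + {#C#} \<Rightarrow>\<^sub>s \<Delta>) \<and>
     V C \<subseteq> Vs \<Sigma> \<inter> Vs (\<Lambda> + \<Delta>)"

definition has_interpolation :: "'c conn set \<Rightarrow> 'c calculus \<Rightarrow> 'c calculus \<Rightarrow> bool" where
  "has_interpolation L G H \<longleftrightarrow>
     (\<forall>\<pi>\<in>proofs L G. \<forall>\<Sigma> \<Lambda> \<Delta>. root \<pi> = (\<Sigma> + \<Lambda> \<Rightarrow>\<^sub>s \<Delta>) \<longrightarrow> (\<exists>C. interpolant L H \<Sigma> \<Lambda> \<Delta> C))"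

text \<open>Since \<open>proof_length \<pi> \<ge> 2\<close>, a bound \<open>c * proof_length \<pi> ^ k + c\<close> is subsumed.\<close>

definition has_feasible_interpolation ::
  "'c conn set \<Rightarrow> 'c calculus \<Rightarrow> 'c calculus \<Rightarrow> bool" where
  "has_feasible_interpolation L G H \<longleftrightarrow>
     (\<exists>k::nat. \<forall>\<pi>\<in>proofs L G. \<forall>\<Sigma> \<Lambda> \<Delta>. root \<pi> = (\<Sigma> + \<Lambda> \<Rightarrow>\<^sub>s \<Delta>) \<longrightarrow>
        (\<exists>C. interpolant L H \<Sigma> \<Lambda> \<Delta> C \<and> form_length C \<le> proof_length \<pi> ^ k))"

end

theory Submission
  imports Defs
begin

text \<open>
  Maehara's method, without cut. By induction on the \<open>H\<close>-proof, an interpolant for a partition of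
  the conclusion of a rule is assembled from one interpolant for each premise. If the principal
  formula belongs to \<open>\<Lambda>\<close> or to the succedent, the interpolants of the premises sharing a
  context are joined by \<open>\<and>\<close>, and the results for the different contexts by \<open>*\<close>. If it belongs to
  \<open>\<Sigma>\<close>, the roles of the two sides are exchanged for all premises except those that carry
  the succedent; the former yield a formula \<open>E\<close> as before, the latter are joined by \<open>\<or>\<close> to a formula
  \<open>C\<close>, and the interpolant is \<open>E \<rightarrow> C\<close> (or \<open>E \<rightarrow> 0\<close> if the succedent is empty). Replacing the
  contexts by the parts of the partition and these formulas gives instances of the same rule, since
  its contexts are independent schematic variables. For a modal rule, \<open>\<box>C\<close> is the interpolant.
  Every premise is used once and contributes only constant overhead, so the length of the
  interpolant stays polynomial in the length of the tree-like proof.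
\<close>

section \<open>Derived rules of extensions of \<open>FL\<^sub>e\<close>\<close>

text \<open>The exchange of sides is dictated by the variable condition. The formulas that a rule
  adds to the contexts of its premises have their atoms in the principal formula \<phi>, so they
  must stay on the side that holds \<phi>. If that side is \<Sigma>, a premise without \<Delta> can
  be read with the two sides swapped, but a premise with \<Delta> cannot, because the atoms of
  \<Delta> belong to the side of \<Lambda>. Hence two formulas E and C of opposite orientation, tied
  together by an implication.

  The obstacle is the left rule for this implication. The multiplicative rule splits \<Lambda>: one
  part proves E, the rest together with C proves \<Delta>. For semi-analytic rules such a split
  exists, since no context belongs to premises of both kinds. If a context is shared, its part of
  \<Lambda> is needed for E and for C alike, which is what the context-sharing implication rule
  provides; moreover the factor of E that belongs to this context has to be weakened into the
  premises that carry \<Delta>.\<close>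

abbreviation langs :: "'c conn set \<Rightarrow> ('a, 'c) fm multiset \<Rightarrow> bool" where
  "langs L M \<equiv> \<forall>\<phi>\<in>#M. in_lang L \<phi>"

definition wf_seq :: "'c conn set \<Rightarrow> 'c sequent \<Rightarrow> bool" where
  "wf_seq L S \<longleftrightarrow> langs L (ante S) \<and> langs L (succ S) \<and> size (succ S) \<le> 1"

lemma in_lang_inst_form:
  assumes "\<forall>n. in_lang L (\<sigma> n)" and "in_lang L \<phi>"
  shows "in_lang L (inst_form \<sigma> \<phi>)"
  using assms(2)
proof (induction \<phi>)
  case (Var x)
  then show ?case using assms(1) by (cases x) auto
qed auto

lemma V_inst_form:
  "V (inst_form \<sigma> \<phi>) = (\<Union>x\<in>V \<phi>. case x of MAtom p \<Rightarrow> {p} | MForm n \<Rightarrow> V (\<sigma> n))"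
proof (induction \<phi>)
  case (Var x)
  then show ?case by (cases x) auto
qed auto

text \<open>The variable conditions of the schemes speak of meta-formulas. They pass to every
  instance because the atoms of an instance depend only on the leaves of the meta-formula.\<close>

lemma Vs_inst_form_mono:
  assumes "Vs M \<subseteq> Vs N"
  shows "Vs (image_mset (inst_form \<sigma>) M) \<subseteq> Vs (image_mset (inst_form \<sigma>) N)"
  using assms unfolding Vs_def by (simp add: V_inst_form) blast

lemma Vs_union [simp]: "Vs (M + N) = Vs M \<union> Vs N"
  and Vs_add_mset [simp]: "Vs (add_mset \<phi> M) = V \<phi> \<union> Vs M"
  and Vs_empty [simp]: "Vs {#} = {}"
  by (auto simp: Vs_def)

lemma Vs_image_Box [simp]: "Vs (image_mset Box M) = Vs M"
  by (auto simp: Vs_def)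

lemma langs_inst_item:
  assumes "\<forall>n. in_lang L (\<sigma> n)" and "\<forall>n. langs L (\<mu> n)" and "item_in_lang L x"
  shows "langs L (inst_item \<sigma> \<mu> x)"
  using assms by (cases x) (auto intro: in_lang_inst_form)

lemma wf_seq_rule_instance:
  assumes "rule_in_lang L r" and "rule_instance L r Ps S"
  shows "wf_seq L S"
proof -
  obtain \<sigma> \<mu> where *: "\<forall>n. in_lang L (\<sigma> n)" "\<forall>n. langs L (\<mu> n)"
    "S = inst_seq \<sigma> \<mu> (concl r)" "single_conclusion S"
    using assms(2) unfolding rule_instance_def by blast
  then show ?thesis
    using assms(1) langs_inst_item[OF *(1,2)]
    by (fastforce simp: wf_seq_def rule_in_lang_def inst_seq_def single_conclusion_def)
qed

lemma wf_seq_root_derivs: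
  assumes "t \<in> derivs L A R" and "\<forall>t\<in>A. wf_seq L (root t)" and "\<forall>r\<in>R. rule_in_lang L r"
  shows "wf_seq L (root t)"
  using assms by induction (auto intro: wf_seq_rule_instance)

lemma wf_seq_root_proofs:
  "calculus_in_lang L G \<Longrightarrow> t \<in> proofs L G \<Longrightarrow> wf_seq L (root t)"
  by (induction G arbitrary: t) (auto intro: wf_seq_root_derivs)

lemma wf_seq_provable:
  "calculus_in_lang L G \<Longrightarrow> provable L G S \<Longrightarrow> wf_seq L S"
  by (auto simp: provable_def wf_seq_root_proofs)

lemma admissibleD:
  assumes "admissible L H r" and "\<forall>n. in_lang L (\<sigma> n)" and "\<forall>n. langs L (\<mu> n)"
    and "calculus_in_lang L H"
    and "\<forall>P\<in>#prems r. provable L H (inst_seq \<sigma> \<mu> P)"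
    and "single_conclusion (inst_seq \<sigma> \<mu> (concl r))"
  shows "provable L H (inst_seq \<sigma> \<mu> (concl r))"
proof -
  have "rule_instance L r (image_mset (inst_seq \<sigma> \<mu>) (prems r)) (inst_seq \<sigma> \<mu> (concl r))"
    using assms wf_seq_provable[OF assms(4)]
    by (auto simp: rule_instance_def wf_seq_def single_conclusion_def)
  then show ?thesis using assms(1,5) by (auto simp: admissible_def)
qed

text \<open>Empty families do occur, as a context need not have any premise. The units \<top>,
  \<bottom> and 1 serve them and contain no atoms, so the variable condition is unaffected.\<close>

definition big_and :: "('a, 'c) fm list \<Rightarrow> ('a, 'c) fm" where
  "big_and Cs = foldr And Cs Top"

definition big_or :: "('a, 'c) fm list \<Rightarrow> ('a, 'c) fm" where
  "big_or Cs = foldr Or Cs Bot"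

definition big_fus :: "('a, 'c) fm list \<Rightarrow> ('a, 'c) fm" where
  "big_fus Cs = foldr Fus Cs One"

lemma big_simps [simp]:
  "big_and [] = Top" "big_and (C # Cs) = And C (big_and Cs)"
  "big_or [] = Bot" "big_or (C # Cs) = Or C (big_or Cs)"
  "big_fus [] = One" "big_fus (C # Cs) = Fus C (big_fus Cs)"
  by (simp_all add: big_and_def big_or_def big_fus_def)

lemma in_lang_big [simp]:
  "in_lang L (big_and Cs) \<longleftrightarrow> (\<forall>C\<in>set Cs. in_lang L C)"
  "in_lang L (big_or Cs) \<longleftrightarrow> (\<forall>C\<in>set Cs. in_lang L C)"
  "in_lang L (big_fus Cs) \<longleftrightarrow> (\<forall>C\<in>set Cs. in_lang L C)"
  by (induction Cs) auto

lemma V_big [simp]: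
  "V (big_and Cs) = (\<Union>C\<in>set Cs. V C)"
  "V (big_or Cs) = (\<Union>C\<in>set Cs. V C)"
  "V (big_fus Cs) = (\<Union>C\<in>set Cs. V C)"
  by (induction Cs) auto

locale FLe_extension =
  fixes L :: "'c conn set" and H :: "'c calculus"
  assumes lang_H: "calculus_in_lang L H" and ext_H: "extends_FLe L H"
begin

abbreviation prv :: "'c form multiset \<Rightarrow> 'c form multiset \<Rightarrow> bool" (infix "\<turnstile>" 45) where
  "\<Gamma> \<turnstile> \<Delta> \<equiv> provable L H (\<Gamma> \<Rightarrow>\<^sub>s \<Delta>)"

text \<open>Instances of a rule carry side conditions on language and succedent size. Recovering
  these from provability keeps them out of most of the derived rules below.\<close>

lemma prvD:
  assumes "\<Gamma> \<turnstile> \<Delta>"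
  shows "langs L \<Gamma>" "langs L \<Delta>" "size \<Delta> \<le> Suc 0"
  using wf_seq_provable[OF lang_H assms] by (auto simp: wf_seq_def)

text \<open>The named rules use only the formula letters 0, 1 and the context letters 0, 1, 2, so
  two formulas and three multisets determine an instance.\<close>

lemma admissible_inst:
  assumes "admissible L H r" and "in_lang L \<phi>" "in_lang L \<psi>" "langs L \<Gamma>" "langs L \<Pi>" "langs L \<Delta>"
  defines "\<sigma> \<equiv> \<lambda>n::nat. if n = 0 then \<phi> else \<psi>"
    and "\<mu> \<equiv> \<lambda>n::nat. if n = 0 then \<Gamma> else if n = 1 then \<Pi> else \<Delta>"
  assumes "\<forall>P\<in>#prems r. provable L H (inst_seq \<sigma> \<mu> P)"
    and "single_conclusion (inst_seq \<sigma> \<mu> (concl r))"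
  shows "provable L H (inst_seq \<sigma> \<mu> (concl r))"
  using assms by (intro admissibleD) (auto simp: lang_H)

lemmas FLe_inst = admissible_inst[OF ext_H[unfolded extends_FLe_def, rule_format]]

lemma prv_OneR: "{#} \<turnstile> {#One#}"
  using FLe_inst[of "Rule {#} ({#} \<Rightarrow>\<^sub>s {#MF One#})" One One "{#}" "{#}" "{#}"]
  by (simp add: FLe_rules_def inst_seq_def single_conclusion_def)

lemma prv_ZeroL: "{#Zero#} \<turnstile> {#}"
  using FLe_inst[of "Rule {#} ({#MF Zero#} \<Rightarrow>\<^sub>s {#})" One One "{#}" "{#}" "{#}"]
  by (simp add: FLe_rules_def inst_seq_def single_conclusion_def)

lemma prv_TopR: "langs L \<Gamma> \<Longrightarrow> \<Gamma> \<turnstile> {#Top#}"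
  using FLe_inst[of "Rule {#} ({#c\<Gamma>#} \<Rightarrow>\<^sub>s {#MF Top#})" One One \<Gamma> "{#}" "{#}"]
  by (simp add: FLe_rules_def inst_seq_def single_conclusion_def)

lemma prv_BotL: "langs L \<Gamma> \<Longrightarrow> langs L \<Delta> \<Longrightarrow> size \<Delta> \<le> 1 \<Longrightarrow> add_mset Bot \<Gamma> \<turnstile> \<Delta>"
  using FLe_inst[of "Rule {#} ({#c\<Gamma>, MF Bot#} \<Rightarrow>\<^sub>s {#c\<Delta>#})" One One \<Gamma> "{#}" \<Delta>]
  by (simp add: FLe_rules_def inst_seq_def single_conclusion_def)

lemma prv_OneL: "\<Gamma> \<turnstile> \<Delta> \<Longrightarrow> add_mset One \<Gamma> \<turnstile> \<Delta>"
  using FLe_inst[of "Rule {#{#c\<Gamma>#} \<Rightarrow>\<^sub>s {#c\<Delta>#}#} ({#c\<Gamma>, MF One#} \<Rightarrow>\<^sub>s {#c\<Delta>#})"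
      One One \<Gamma> "{#}" \<Delta>]
  by (simp add: FLe_rules_def inst_seq_def single_conclusion_def prvD)

lemma prv_ZeroR: "\<Gamma> \<turnstile> {#} \<Longrightarrow> \<Gamma> \<turnstile> {#Zero#}"
  using FLe_inst[of "Rule {#{#c\<Gamma>#} \<Rightarrow>\<^sub>s {#}#} ({#c\<Gamma>#} \<Rightarrow>\<^sub>s {#MF Zero#})" One One \<Gamma> "{#}" "{#}"]
  by (simp add: FLe_rules_def inst_seq_def single_conclusion_def prvD)

lemma prv_AndL1: "add_mset \<phi> \<Gamma> \<turnstile> \<Delta> \<Longrightarrow> in_lang L \<psi> \<Longrightarrow> add_mset (And \<phi> \<psi>) \<Gamma> \<turnstile> \<Delta>"
  using FLe_inst[of "Rule {#{#c\<Gamma>, MF m\<phi>#} \<Rightarrow>\<^sub>s {#c\<Delta>#}#} ({#c\<Gamma>, MF (And m\<phi> m\<psi>)#} \<Rightarrow>\<^sub>s {#c\<Delta>#})"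
      \<phi> \<psi> \<Gamma> "{#}" \<Delta>] prvD[of "add_mset \<phi> \<Gamma>" \<Delta>]
  by (simp add: FLe_rules_def inst_seq_def single_conclusion_def)

lemma prv_AndL2: "add_mset \<psi> \<Gamma> \<turnstile> \<Delta> \<Longrightarrow> in_lang L \<phi> \<Longrightarrow> add_mset (And \<phi> \<psi>) \<Gamma> \<turnstile> \<Delta>"
  using FLe_inst[of "Rule {#{#c\<Gamma>, MF m\<psi>#} \<Rightarrow>\<^sub>s {#c\<Delta>#}#} ({#c\<Gamma>, MF (And m\<phi> m\<psi>)#} \<Rightarrow>\<^sub>s {#c\<Delta>#})"
      \<phi> \<psi> \<Gamma> "{#}" \<Delta>] prvD[of "add_mset \<psi> \<Gamma>" \<Delta>]
  by (simp add: FLe_rules_def inst_seq_def single_conclusion_def)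

lemma prv_AndR: "\<Gamma> \<turnstile> {#\<phi>#} \<Longrightarrow> \<Gamma> \<turnstile> {#\<psi>#} \<Longrightarrow> \<Gamma> \<turnstile> {#And \<phi> \<psi>#}"
  using FLe_inst[of "Rule {#{#c\<Gamma>#} \<Rightarrow>\<^sub>s {#MF m\<phi>#}, {#c\<Gamma>#} \<Rightarrow>\<^sub>s {#MF m\<psi>#}#}
      ({#c\<Gamma>#} \<Rightarrow>\<^sub>s {#MF (And m\<phi> m\<psi>)#})" \<phi> \<psi> \<Gamma> "{#}" "{#}"]
    prvD[of \<Gamma> "{#\<phi>#}"] prvD[of \<Gamma> "{#\<psi>#}"]
  by (simp add: FLe_rules_def inst_seq_def single_conclusion_def)

lemma prv_OrL: "add_mset \<phi> \<Gamma> \<turnstile> \<Delta> \<Longrightarrow> add_mset \<psi> \<Gamma> \<turnstile> \<Delta> \<Longrightarrow> add_mset (Or \<phi> \<psi>) \<Gamma> \<turnstile> \<Delta>"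
  using FLe_inst[of "Rule {#{#c\<Gamma>, MF m\<phi>#} \<Rightarrow>\<^sub>s {#c\<Delta>#}, {#c\<Gamma>, MF m\<psi>#} \<Rightarrow>\<^sub>s {#c\<Delta>#}#}
      ({#c\<Gamma>, MF (Or m\<phi> m\<psi>)#} \<Rightarrow>\<^sub>s {#c\<Delta>#})" \<phi> \<psi> \<Gamma> "{#}" \<Delta>]
    prvD[of "add_mset \<phi> \<Gamma>" \<Delta>] prvD[of "add_mset \<psi> \<Gamma>" \<Delta>]
  by (simp add: FLe_rules_def inst_seq_def single_conclusion_def)

lemma prv_OrR1: "\<Gamma> \<turnstile> {#\<phi>#} \<Longrightarrow> in_lang L \<psi> \<Longrightarrow> \<Gamma> \<turnstile> {#Or \<phi> \<psi>#}"
  using FLe_inst[of "Rule {#{#c\<Gamma>#} \<Rightarrow>\<^sub>s {#MF m\<phi>#}#} ({#c\<Gamma>#} \<Rightarrow>\<^sub>s {#MF (Or m\<phi> m\<psi>)#})"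
      \<phi> \<psi> \<Gamma> "{#}" "{#}"] prvD[of \<Gamma> "{#\<phi>#}"]
  by (simp add: FLe_rules_def inst_seq_def single_conclusion_def)

lemma prv_OrR2: "\<Gamma> \<turnstile> {#\<psi>#} \<Longrightarrow> in_lang L \<phi> \<Longrightarrow> \<Gamma> \<turnstile> {#Or \<phi> \<psi>#}"
  using FLe_inst[of "Rule {#{#c\<Gamma>#} \<Rightarrow>\<^sub>s {#MF m\<psi>#}#} ({#c\<Gamma>#} \<Rightarrow>\<^sub>s {#MF (Or m\<phi> m\<psi>)#})"
      \<phi> \<psi> \<Gamma> "{#}" "{#}"] prvD[of \<Gamma> "{#\<psi>#}"]
  by (simp add: FLe_rules_def inst_seq_def single_conclusion_def)

lemma prv_FusL: "add_mset \<phi> (add_mset \<psi> \<Gamma>) \<turnstile> \<Delta> \<Longrightarrow> add_mset (Fus \<phi> \<psi>) \<Gamma> \<turnstile> \<Delta>"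
  using FLe_inst[of "Rule {#{#c\<Gamma>, MF m\<phi>, MF m\<psi>#} \<Rightarrow>\<^sub>s {#c\<Delta>#}#}
      ({#c\<Gamma>, MF (Fus m\<phi> m\<psi>)#} \<Rightarrow>\<^sub>s {#c\<Delta>#})" \<phi> \<psi> \<Gamma> "{#}" \<Delta>]
    prvD[of "add_mset \<phi> (add_mset \<psi> \<Gamma>)" \<Delta>]
  by (simp add: FLe_rules_def inst_seq_def single_conclusion_def add_mset_commute)

lemma prv_FusR: "\<Gamma> \<turnstile> {#\<phi>#} \<Longrightarrow> \<Pi> \<turnstile> {#\<psi>#} \<Longrightarrow> \<Gamma> + \<Pi> \<turnstile> {#Fus \<phi> \<psi>#}"
  using FLe_inst[of "Rule {#{#c\<Gamma>#} \<Rightarrow>\<^sub>s {#MF m\<phi>#}, {#c\<Sigma>#} \<Rightarrow>\<^sub>s {#MF m\<psi>#}#}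
      ({#c\<Gamma>, c\<Sigma>#} \<Rightarrow>\<^sub>s {#MF (Fus m\<phi> m\<psi>)#})" \<phi> \<psi> \<Gamma> \<Pi> "{#}"]
    prvD[of \<Gamma> "{#\<phi>#}"] prvD[of \<Pi> "{#\<psi>#}"]
  by (simp add: FLe_rules_def inst_seq_def single_conclusion_def)

lemma prv_ImpL: "\<Gamma> \<turnstile> {#\<phi>#} \<Longrightarrow> add_mset \<psi> \<Pi> \<turnstile> \<Delta> \<Longrightarrow> add_mset (Imp \<phi> \<psi>) (\<Gamma> + \<Pi>) \<turnstile> \<Delta>"
  using FLe_inst[of "Rule {#{#c\<Gamma>#} \<Rightarrow>\<^sub>s {#MF m\<phi>#}, {#c\<Sigma>, MF m\<psi>#} \<Rightarrow>\<^sub>s {#c\<Delta>#}#}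
      ({#c\<Gamma>, c\<Sigma>, MF (Imp m\<phi> m\<psi>)#} \<Rightarrow>\<^sub>s {#c\<Delta>#})" \<phi> \<psi> \<Gamma> \<Pi> \<Delta>]
    prvD[of \<Gamma> "{#\<phi>#}"] prvD[of "add_mset \<psi> \<Pi>" \<Delta>]
  by (simp add: FLe_rules_def inst_seq_def single_conclusion_def)

lemma prv_ImpR: "add_mset \<phi> \<Gamma> \<turnstile> {#\<psi>#} \<Longrightarrow> \<Gamma> \<turnstile> {#Imp \<phi> \<psi>#}"
  using FLe_inst[of "Rule {#{#c\<Gamma>, MF m\<phi>#} \<Rightarrow>\<^sub>s {#MF m\<psi>#}#} ({#c\<Gamma>#} \<Rightarrow>\<^sub>s {#MF (Imp m\<phi> m\<psi>)#})"
      \<phi> \<psi> \<Gamma> "{#}" "{#}"] prvD[of "add_mset \<phi> \<Gamma>" "{#\<psi>#}"]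
  by (simp add: FLe_rules_def inst_seq_def single_conclusion_def)

lemma prv_weaken_Box:
  assumes "admissible L H left_weakening_boxed" and "BoxC \<in> L" and "\<Gamma> \<turnstile> \<Delta>" and "in_lang L \<phi>"
  shows "add_mset (Box \<phi>) \<Gamma> \<turnstile> \<Delta>"
  using admissible_inst[OF assms(1), of \<phi> \<phi> \<Gamma> "{#}" \<Delta>] assms prvD[OF assms(3)]
  by (simp add: left_weakening_boxed_def inst_seq_def single_conclusion_def)

lemma prv_weaken:
  assumes "admissible L H left_weakening" and "\<Gamma> \<turnstile> \<Delta>" and "langs L \<Pi>"
  shows "\<Gamma> + \<Pi> \<turnstile> \<Delta>"
  using assms(3)
proof (induction \<Pi>)
  case empty
  then show ?case using assms(2) by simp
next
  case (add \<phi> \<Pi>)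
  then have *: "\<Gamma> + \<Pi> \<turnstile> \<Delta>" by simp
  show ?case
    using admissible_inst[OF assms(1), of \<phi> \<phi> "\<Gamma> + \<Pi>" "{#}" \<Delta>] prvD[OF *] * add.prems
    by (simp add: left_weakening_def inst_seq_def single_conclusion_def)
qed

lemma prv_ImpL_shared:
  assumes "admissible L H context_sharing_left_imp" and "\<Gamma> \<turnstile> {#\<phi>#}" and "add_mset \<psi> \<Gamma> \<turnstile> \<Delta>"
  shows "add_mset (Imp \<phi> \<psi>) \<Gamma> \<turnstile> \<Delta>"
  using admissible_inst[OF assms(1), of \<phi> \<psi> \<Gamma> "{#}" \<Delta>] assms(2,3) prvD[OF assms(2)]
    prvD[OF assms(3)]
  by (simp add: context_sharing_left_imp_def inst_seq_def single_conclusion_def)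

lemma prv_big_andR:
  assumes "langs L \<Gamma>" and "\<forall>C\<in>set Cs. \<Gamma> \<turnstile> {#C#}"
  shows "\<Gamma> \<turnstile> {#big_and Cs#}"
  using assms(2) by (induction Cs) (use assms(1) in \<open>auto intro: prv_TopR prv_AndR\<close>)

lemma prv_big_andL:
  assumes "C \<in> set Cs" and "\<forall>C\<in>set Cs. in_lang L C" and "add_mset C \<Gamma> \<turnstile> \<Delta>"
  shows "add_mset (big_and Cs) \<Gamma> \<turnstile> \<Delta>"
  using assms(1,2) by (induction Cs) (auto intro: prv_AndL1 prv_AndL2 assms(3))

lemma prv_big_orL:
  assumes "langs L \<Gamma>" "langs L \<Delta>" "size \<Delta> \<le> 1" and "\<forall>C\<in>set Cs. add_mset C \<Gamma> \<turnstile> \<Delta>"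
  shows "add_mset (big_or Cs) \<Gamma> \<turnstile> \<Delta>"
  using assms(4) by (induction Cs) (use assms(1-3) in \<open>auto intro: prv_BotL prv_OrL\<close>)

lemma prv_big_orR:
  assumes "C \<in> set Cs" and "\<forall>C\<in>set Cs. in_lang L C" and "\<Gamma> \<turnstile> {#C#}"
  shows "\<Gamma> \<turnstile> {#big_or Cs#}"
  using assms(1,2) by (induction Cs) (auto intro: prv_OrR1 prv_OrR2 assms(3))

lemma prv_big_fusL:
  assumes "mset Cs + \<Gamma> \<turnstile> \<Delta>"
  shows "add_mset (big_fus Cs) \<Gamma> \<turnstile> \<Delta>"
  using assms
proof (induction Cs arbitrary: \<Gamma>)
  case Nil
  then show ?case by (simp add: prv_OneL)
next
  case (Cons C Cs)
  then show ?case using Cons.IH[of "add_mset C \<Gamma>"] by (simp add: prv_FusL add_mset_commute)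
qed

text \<open>
  \<open>fusible Ds A\<close> says that \<open>A\<close> splits into parts proving the members of \<open>Ds\<close>. It is phrased so
  that it can be accumulated over several contexts without an inversion principle for \<open>*\<close>.
\<close>

definition fusible :: "'c form list \<Rightarrow> 'c form multiset \<Rightarrow> bool" where
  "fusible Ds A \<longleftrightarrow> (\<forall>B Cs. B \<turnstile> {#big_fus Cs#} \<longrightarrow> A + B \<turnstile> {#big_fus (Ds @ Cs)#})"

lemma fusible_Nil: "fusible [] {#}"
  by (simp add: fusible_def)

lemma fusible_single: "A \<turnstile> {#D#} \<Longrightarrow> fusible [D] A"
  by (simp add: fusible_def prv_FusR)

lemma fusible_append: "fusible Ds A \<Longrightarrow> fusible Es B \<Longrightarrow> fusible (Ds @ Es) (A + B)"
  by (simp add: fusible_def add.assoc)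

lemma fusible_concat:
  assumes "distinct gs" and "\<forall>g\<in>set gs. fusible (Ds g) (A g)"
  shows "fusible (concat (map Ds gs)) (\<Sum>g\<in>set gs. A g)"
  using assms by (induction gs) (auto intro: fusible_Nil fusible_append)

text \<open>The neutral case \<open>Cs = []\<close>, \<open>B = {#}\<close> of
  \<open>fusible\<close>, started by the axiom for 1.\<close>

lemma prv_big_fusR: "fusible Ds A \<Longrightarrow> A \<turnstile> {#big_fus Ds#}"
  using prv_OneR unfolding fusible_def by (metis add.right_neutral append_Nil2 big_simps(5))

end

section \<open>Semi-analytic rules with their premises grouped by context\<close>

lemma mset_concat_distinct:
  "distinct gs \<Longrightarrow> mset (concat (map f gs)) = (\<Sum>g\<in>set gs. mset (f g))"
  by (induction gs) auto

lemma langs_sum: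
  "finite I \<Longrightarrow> langs L (\<Sum>i\<in>I. M i) \<longleftrightarrow> (\<forall>i\<in>I. langs L (M i))"
  by (induction rule: finite_induct) auto

lemma Vs_sum: "finite I \<Longrightarrow> Vs (\<Sum>i\<in>I. M i) = (\<Union>i\<in>I. Vs (M i))"
  by (induction rule: finite_induct) auto

lemma size_sum:
  fixes M :: "'i \<Rightarrow> 'a multiset"
  shows "finite I \<Longrightarrow> size (\<Sum>i\<in>I. M i) = (\<Sum>i\<in>I. size (M i))"
  by (induction rule: finite_induct) auto

lemma sum_eq_empty_iff:
  fixes M :: "'i \<Rightarrow> 'a multiset"
  shows "finite I \<Longrightarrow> (\<Sum>i\<in>I. M i) = {#} \<longleftrightarrow> (\<forall>i\<in>I. M i = {#})"
  by (induction rule: finite_induct) auto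

section \<open>Common refinements of multiset partitions\<close>

lemma nat_sum_refine:
  fixes a b c d :: nat
  assumes "a + b = c + d"
  shows "d = (a - c) + (d - (a - c))" "b = (c - a) + (d - (a - c))"
  using assms by arith+

text \<open>The four pieces are the intersection of \<open>A\<close> and \<open>C\<close>, the
  differences \<open>C - A\<close> and \<open>A - C\<close>, and what remains of \<open>D\<close>
  after \<open>A - C\<close>.\<close>

lemma multiset_refine:
  fixes A B C D :: "'a multiset"
  assumes "A + B = C + D"
  shows "\<exists>C1 C2 D1 D2. C = C1 + C2 \<and> D = D1 + D2 \<and> A = C1 + D1 \<and> B = C2 + D2"
proof (intro exI conjI)
  have *: "count A x + count B x = count C x + count D x" for x
    using assms by (metis count_union)
  show "C = (A \<inter># C) + (C - A)" "A = (A \<inter># C) + (A - C)"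
    by (auto simp: multiset_eq_iff)
  show "D = (A - C) + (D - (A - C))" "B = (C - A) + (D - (A - C))"
    by (rule multiset_eqI, unfold count_union count_diff, rule nat_sum_refine[OF *])+
qed

text \<open>The partition to be interpolated cuts across the contexts of a rule instance. Here each
  context \<open>M i\<close> is cut into its share \<open>A i\<close> of \<Sigma> and its share
  \<open>B i\<close> of \<Lambda>.\<close>

lemma multiset_sum_refine:
  fixes M :: "'i \<Rightarrow> 'a multiset"
  assumes "finite I" and "\<Sigma> + \<Lambda> = (\<Sum>i\<in>I. M i)"
  shows "\<exists>A B. (\<forall>i\<in>I. M i = A i + B i) \<and> \<Sigma> = (\<Sum>i\<in>I. A i) \<and> \<Lambda> = (\<Sum>i\<in>I. B i)"
  using assms
proof (induction arbitrary: \<Sigma> \<Lambda> rule: finite_induct)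
  case empty
  then show ?case by simp
next
  case (insert i I)
  then have "\<Sigma> + \<Lambda> = M i + (\<Sum>i\<in>I. M i)" by simp
  from multiset_refine[OF this] obtain C1 C2 D1 D2 where
    *: "M i = C1 + C2" "(\<Sum>i\<in>I. M i) = D1 + D2" "\<Sigma> = C1 + D1" "\<Lambda> = C2 + D2"
    by blast
  obtain A B where **: "\<forall>i\<in>I. M i = A i + B i" "D1 = (\<Sum>i\<in>I. A i)" "D2 = (\<Sum>i\<in>I. B i)"
    using insert.IH[of D1 D2] *(2) by auto
  have "(\<Sum>j\<in>I. (A(i := C1)) j) = sum A I" "(\<Sum>j\<in>I. (B(i := C2)) j) = sum B I"
    using insert.hyps(2) by (auto intro!: sum.cong)
  then have "(\<forall>j\<in>insert i I. M j = (A(i := C1)) j + (B(i := C2)) j) \<and>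
      \<Sigma> = sum (A(i := C1)) (insert i I) \<and> \<Lambda> = sum (B(i := C2)) (insert i I)"
    using * ** insert.hyps by auto
  then show ?case by blast
qed

datatype 'c grp = Grp (gctx: nat) (gsuc: "nat option")
  (side: "('c mform multiset \<times> 'c mform multiset) list") (main: "'c mform multiset list")

definition suc_items :: "'c grp \<Rightarrow> 'c item multiset" where
  "suc_items g = (case gsuc g of None \<Rightarrow> {#} | Some d \<Rightarrow> {#Ctx d#})"

definition grp_prems :: "'c grp \<Rightarrow> 'c item seq list" where
  "grp_prems g =
     map (\<lambda>(\<psi>s, \<theta>s). add_mset (Ctx (gctx g)) (image_mset MF \<psi>s) \<Rightarrow>\<^sub>s image_mset MF \<theta>s) (side g) @
     map (\<lambda>\<phi>s. add_mset (Ctx (gctx g)) (image_mset MF \<phi>s) \<Rightarrow>\<^sub>s suc_items g) (main g)"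

text \<open>
  The common shape of left, right and context-sharing semi-analytic rules. Here \<open>\<Phi>\<close> and \<open>\<Theta>\<close> are
  the left and the right principal formulas, and a group collects the premises with the same context
  \<open>\<Gamma>\<^sub>i\<close>, of which only the main ones carry \<open>\<Delta>\<^sub>i\<close>; there is no \<open>\<Delta>\<^sub>i\<close> if \<open>gsuc\<close> is \<open>None\<close>.
\<close>

definition grouped ::
  "'c rule \<Rightarrow> 'c grp list \<Rightarrow> 'c mform multiset \<Rightarrow> 'c mform multiset \<Rightarrow> bool" where
  "grouped r gs \<Phi> \<Theta> \<longleftrightarrow>
     distinct (map gctx gs) \<and>
     (\<forall>g\<in>set gs. \<forall>g'\<in>set gs. \<forall>d. gsuc g = Some d \<longrightarrow>
        d \<noteq> gctx g' \<and> (gsuc g' = Some d \<longrightarrow> g = g')) \<and>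
     (\<forall>g\<in>set gs. (\<forall>(\<psi>s, \<theta>s)\<in>set (side g). Vs \<psi>s \<union> Vs \<theta>s \<subseteq> Vs (\<Phi> + \<Theta>)) \<and>
        (\<forall>\<phi>s\<in>set (main g). Vs \<phi>s \<subseteq> Vs (\<Phi> + \<Theta>))) \<and>
     prems r = mset (concat (map grp_prems gs)) \<and>
     concl r = (mset (map (\<lambda>g. Ctx (gctx g)) gs) + image_mset MF \<Phi> \<Rightarrow>\<^sub>s
       (\<Sum>g\<in>set gs. suc_items g) + image_mset MF \<Theta>)"

abbreviation inst_mset :: "(nat \<Rightarrow> 'c form) \<Rightarrow> 'c mform multiset \<Rightarrow> 'c form multiset" where
  "inst_mset \<sigma> \<equiv> image_mset (inst_form \<sigma>)"

definition side_prems ::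
  "(nat \<Rightarrow> 'c form) \<Rightarrow> 'c grp \<Rightarrow> ('c form multiset \<times> 'c form multiset) list" where
  "side_prems \<sigma> g = map (map_prod (inst_mset \<sigma>) (inst_mset \<sigma>)) (side g)"

definition main_prems :: "(nat \<Rightarrow> 'c form) \<Rightarrow> 'c grp \<Rightarrow> 'c form multiset list" where
  "main_prems \<sigma> g = map (inst_mset \<sigma>) (main g)"

text \<open>The succedent \<open>D\<close> of the main premises is a parameter because a group is
  used with two of them: the given one and an interpolant put in its place.\<close>

definition all_prems ::
  "(nat \<Rightarrow> 'c form) \<Rightarrow> 'c form multiset \<Rightarrow> 'c grp \<Rightarrow> ('c form multiset \<times> 'c form multiset) list"
  where
  "all_prems \<sigma> D g = side_prems \<sigma> g @ map (\<lambda>\<phi>s. (\<phi>s, D)) (main_prems \<sigma> g)"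

lemma sum_mset_inst_items [simp]:
  "(\<Sum>x\<in>#image_mset MF M. inst_item \<sigma> \<mu> x) = inst_mset \<sigma> M"
  "(\<Sum>x\<in>#M. {#inst_form \<sigma> x#}) = inst_mset \<sigma> M"
  by (induction M) auto

lemma inst_grp_prems:
  assumes "\<mu> (gctx g) = M" and "(case gsuc g of None \<Rightarrow> {#} | Some d \<Rightarrow> \<mu> d) = D"
  shows "map (inst_seq \<sigma> \<mu>) (grp_prems g) = map (\<lambda>(\<psi>, \<theta>). M + \<psi> \<Rightarrow>\<^sub>s \<theta>) (all_prems \<sigma> D g)"
  using assms by (auto simp: grp_prems_def all_prems_def side_prems_def main_prems_def
      inst_seq_def suc_items_def multiset.map_comp comp_def split: option.splits)

lemma inst_grouped:
  assumes "grouped r gs \<Phi> \<Theta>"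
    and "\<forall>g\<in>set gs. \<mu> (gctx g) = M g \<and> (case gsuc g of None \<Rightarrow> {#} | Some d \<Rightarrow> \<mu> d) = D g"
  shows "image_mset (inst_seq \<sigma> \<mu>) (prems r) =
      (\<Sum>g\<in>set gs. image_mset (\<lambda>(\<psi>, \<theta>). M g + \<psi> \<Rightarrow>\<^sub>s \<theta>) (mset (all_prems \<sigma> (D g) g)))"
    and "inst_seq \<sigma> \<mu> (concl r) =
      ((\<Sum>g\<in>set gs. M g) + inst_mset \<sigma> \<Phi> \<Rightarrow>\<^sub>s (\<Sum>g\<in>set gs. D g) + inst_mset \<sigma> \<Theta>)"
proof -
  have d: "distinct gs" using assms(1) by (auto simp: grouped_def distinct_map)
  have "image_mset (inst_seq \<sigma> \<mu>) (prems r) =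
      mset (concat (map (\<lambda>g. map (inst_seq \<sigma> \<mu>) (grp_prems g)) gs))"
    using assms(1) by (simp add: grouped_def map_concat comp_def flip: mset_map)
  also have "\<dots> = (\<Sum>g\<in>set gs. mset (map (inst_seq \<sigma> \<mu>) (grp_prems g)))"
    by (rule mset_concat_distinct[OF d])
  also have "\<dots> =
      (\<Sum>g\<in>set gs. image_mset (\<lambda>(\<psi>, \<theta>). M g + \<psi> \<Rightarrow>\<^sub>s \<theta>) (mset (all_prems \<sigma> (D g) g)))"
    using assms(2) by (intro sum.cong refl) (simp only: inst_grp_prems mset_map)
  finally show "image_mset (inst_seq \<sigma> \<mu>) (prems r) =
      (\<Sum>g\<in>set gs. image_mset (\<lambda>(\<psi>, \<theta>). M g + \<psi> \<Rightarrow>\<^sub>s \<theta>) (mset (all_prems \<sigma> (D g) g)))" .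
  have "(\<Sum>x\<in>#mset (map (\<lambda>g. Ctx (gctx g)) gs). inst_item \<sigma> \<mu> x) = (\<Sum>g\<in>set gs. M g)"
    using d assms(2) by (induction gs) auto
  moreover have "(\<Sum>x\<in>#(\<Sum>g\<in>set gs. suc_items g). inst_item \<sigma> \<mu> x) = (\<Sum>g\<in>set gs. D g)"
    using d assms(2) by (induction gs) (auto simp: suc_items_def split: option.splits)
  ultimately show "inst_seq \<sigma> \<mu> (concl r) =
      ((\<Sum>g\<in>set gs. M g) + inst_mset \<sigma> \<Phi> \<Rightarrow>\<^sub>s (\<Sum>g\<in>set gs. D g) + inst_mset \<sigma> \<Theta>)"
    using assms(1) by (simp add: grouped_def inst_seq_def multiset.map_comp comp_def)
qed

text \<open>All context and succedent variables of a grouped rule are pairwise distinct, so the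
  required values define a partial function \<open>P\<close> on indices, and any choice of values is
  realised by an instance.\<close>

lemma ex_context_assignment:
  assumes "grouped r gs \<Phi> \<Theta>" and "\<forall>g\<in>set gs. langs L (M g) \<and> langs L (D g)"
    and "\<forall>g\<in>set gs. gsuc g = None \<longrightarrow> D g = {#}"
  shows "\<exists>\<mu>. (\<forall>n. langs L (\<mu> n)) \<and>
    (\<forall>g\<in>set gs. \<mu> (gctx g) = M g \<and> (case gsuc g of None \<Rightarrow> {#} | Some d \<Rightarrow> \<mu> d) = D g)"
proof -
  define P where "P n X \<longleftrightarrow> (\<exists>g\<in>set gs. gctx g = n \<and> X = M g \<or> gsuc g = Some n \<and> X = D g)" for n X
  have uniq: "X = Y" if "P n X" "P n Y" for n X Y
  proof -
    from that obtain g g' where g: "g \<in> set gs" "gctx g = n \<and> X = M g \<or> gsuc g = Some n \<and> X = D g"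
      and g': "g' \<in> set gs" "gctx g' = n \<and> Y = M g' \<or> gsuc g' = Some n \<and> Y = D g'"
      unfolding P_def by blast
    have "gctx g = gctx g' \<Longrightarrow> g = g'" "gsuc g = Some n \<Longrightarrow> gctx g' \<noteq> n"
      "gsuc g' = Some n \<Longrightarrow> gctx g \<noteq> n" "gsuc g = Some n \<Longrightarrow> gsuc g' = Some n \<Longrightarrow> g = g'"
      using assms(1) g(1) g'(1) unfolding grouped_def distinct_map inj_on_def by blast+
    then show ?thesis using g(2) g'(2) by metis
  qed
  \<comment> \<open>Variables foreign to the rule receive \<open>{#}\<close>, which lies in the
    language trivially.\<close>
  define \<mu> where "\<mu> n = (if \<exists>X. P n X then THE X. P n X else {#})" for n
  have \<mu>: "\<mu> n = X" if "P n X" for n X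
  proof -
    have "(THE X. P n X) = X" using that by (rule the_equality) (rule uniq[OF _ that])
    then show ?thesis using that by (auto simp: \<mu>_def)
  qed
  have "langs L (\<mu> n)" for n
  proof (cases "\<exists>X. P n X")
    case True
    then obtain X where "P n X" by blast
    with \<mu>[OF this] assms(2) show ?thesis by (auto simp: P_def)
  qed (simp add: \<mu>_def)
  moreover have "\<mu> (gctx g) = M g" if "g \<in> set gs" for g
    using that by (intro \<mu>) (auto simp: P_def)
  moreover have "\<mu> d = D g" if "g \<in> set gs" "gsuc g = Some d" for g d
    using that by (intro \<mu>) (auto simp: P_def)
  ultimately show ?thesis using assms(3) by (intro exI[of _ \<mu>]) (auto split: option.splits)
qed

section \<open>Interpolants for the conclusion of a rule\<close>

text \<open>The weight \<open>w\<close> covers both statements: it is the length for feasible interpolation and \<open>0\<close> for plain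
  interpolation, where no bound is available.\<close>

locale FLe_interpolation = FLe_extension L H for L :: "'c conn set" and H :: "'c calculus" +
  fixes w :: "'c form \<Rightarrow> nat"
  assumes weight: "w = form_length \<or> w = (\<lambda>_. 0)"
begin

text \<open>Stated as upper bounds because the zero weight has to satisfy them too.\<close>

lemma w_simps:
  "w One \<le> 1" "w Zero \<le> 1" "w Top \<le> 1" "w Bot \<le> 1"
  "w (And C D) \<le> Suc (w C + w D)" "w (Or C D) \<le> Suc (w C + w D)"
  "w (Fus C D) \<le> Suc (w C + w D)" "w (Imp C D) \<le> Suc (w C + w D)" "w (Box C) \<le> Suc (w C)"
  using weight by auto

lemma w_big:
  "w (big_and Cs) \<le> (\<Sum>C\<leftarrow>Cs. Suc (w C)) + 1"
  "w (big_or Cs) \<le> (\<Sum>C\<leftarrow>Cs. Suc (w C)) + 1"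
  "w (big_fus Cs) \<le> (\<Sum>C\<leftarrow>Cs. Suc (w C)) + 1"
  using weight by (induction Cs) auto

text \<open>The bound \<beta> depends on the sequent and not on a proof of it, so that single rule
  instances can be studied without reference to subproofs.\<close>

definition interpolable :: "('c sequent \<Rightarrow> nat) \<Rightarrow> 'c sequent \<Rightarrow> bool" where
  "interpolable \<beta> P \<longleftrightarrow>
     (\<forall>\<Sigma> \<Lambda> \<Delta>. P = (\<Sigma> + \<Lambda> \<Rightarrow>\<^sub>s \<Delta>) \<longrightarrow> (\<exists>C. interpolant L H \<Sigma> \<Lambda> \<Delta> C \<and> w C \<le> \<beta> P))"

text \<open>\<open>A\<close> is the part that proves the interpolant, \<open>B\<close> the part that
  uses it; callers choose which of them belongs to \<Sigma>. A list \<open>Ds\<close> allows a group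
  to contribute nothing at all. In the bound, 3 per premise covers its interpolant's connective and
  a share of the overhead, and \<open>2 * size A\<close> covers the overhead of a group without
  premises.\<close>

definition group_interpolant ::
  "('c sequent \<Rightarrow> nat) \<Rightarrow> 'c form multiset \<Rightarrow> 'c form multiset \<Rightarrow>
   ('c form multiset \<times> 'c form multiset) list \<Rightarrow> 'c form list \<Rightarrow> bool" where
  "group_interpolant \<beta> A B X Ds \<longleftrightarrow>
     langs L (mset Ds) \<and> fusible Ds A \<and> (\<forall>(\<psi>, \<theta>)\<in>set X. mset Ds + B + \<psi> \<turnstile> \<theta>) \<and>
     Vs (mset Ds) \<subseteq> Vs A \<inter> (\<Union>(\<psi>, \<theta>)\<in>set X. Vs (B + \<psi> + \<theta>)) \<and>
     (\<Sum>D\<leftarrow>Ds. Suc (w D)) \<le> (\<Sum>(\<psi>, \<theta>)\<leftarrow>X. \<beta> (A + B + \<psi> \<Rightarrow>\<^sub>s \<theta>) + 3) + 2 * size A"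

lemma group_interpolantD:
  assumes "group_interpolant \<beta> A B X Ds"
  shows "langs L (mset Ds)" "fusible Ds A" "(\<psi>, \<theta>) \<in> set X \<Longrightarrow> mset Ds + B + \<psi> \<turnstile> \<theta>"
    "Vs (mset Ds) \<subseteq> Vs A \<inter> (\<Union>(\<psi>, \<theta>)\<in>set X. Vs (B + \<psi> + \<theta>))"
    "(\<Sum>D\<leftarrow>Ds. Suc (w D)) \<le> (\<Sum>(\<psi>, \<theta>)\<leftarrow>X. \<beta> (A + B + \<psi> \<Rightarrow>\<^sub>s \<theta>) + 3) + 2 * size A"
  using assms unfolding group_interpolant_def by blast+

text \<open>
  One formula interpolates all premises sharing the context \<open>A + B\<close>. The case without
  premises and with \<open>A = {#}\<close> is kept free of \<open>\<top>\<close>, since the number of such contexts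
  is not bounded by the length of the proof.
\<close>

lemma ex_group_interpolant:
  assumes "langs L A" and "\<forall>(\<psi>, \<theta>)\<in>set X. interpolable \<beta> (A + B + \<psi> \<Rightarrow>\<^sub>s \<theta>)"
  shows "\<exists>Ds. group_interpolant \<beta> A B X Ds"
proof (cases "X = [] \<and> A = {#}")
  case True
  then show ?thesis by (intro exI[of _ "[]"]) (simp add: group_interpolant_def fusible_Nil)
next
  case False
  have "\<forall>x\<in>set X. \<exists>C. interpolant L H A (B + fst x) (snd x) C \<and>
      w C \<le> \<beta> (A + B + fst x \<Rightarrow>\<^sub>s snd x)"
    using assms(2) by (fastforce simp: interpolable_def add.assoc)
  then obtain f where f: "\<And>x. x \<in> set X \<Longrightarrow> interpolant L H A (B + fst x) (snd x) (f x)"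
    "\<And>x. x \<in> set X \<Longrightarrow> w (f x) \<le> \<beta> (A + B + fst x \<Rightarrow>\<^sub>s snd x)"
    by metis
  let ?D = "big_and (map f X)"
  have lang: "\<forall>C\<in>set (map f X). in_lang L C"
    using f(1) by (auto simp: interpolant_def)
  have "A \<turnstile> {#?D#}"
    using f(1) by (intro prv_big_andR assms(1)) (auto simp: interpolant_def)
  moreover have "add_mset ?D (B + \<psi>) \<turnstile> \<theta>" if "(\<psi>, \<theta>) \<in> set X" for \<psi> \<theta>
    using f(1)[OF that] that lang
    by (intro prv_big_andL[of "f (\<psi>, \<theta>)"]) (auto simp: interpolant_def)
  moreover have "V ?D \<subseteq> Vs A \<inter> (\<Union>(\<psi>, \<theta>)\<in>set X. Vs (B + \<psi> + \<theta>))"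
    using f(1) by (fastforce simp: interpolant_def)
  moreover have "Suc (w ?D) \<le> (\<Sum>(\<psi>, \<theta>)\<leftarrow>X. \<beta> (A + B + \<psi> \<Rightarrow>\<^sub>s \<theta>) + 3) + 2 * size A"
  proof -
    have "(\<Sum>x\<leftarrow>X. Suc (w (f x))) + 2 * length X \<le> (\<Sum>(\<psi>, \<theta>)\<leftarrow>X. \<beta> (A + B + \<psi> \<Rightarrow>\<^sub>s \<theta>) + 3)"
      using f(2) by (induction X) fastforce+
    moreover have "Suc (w ?D) \<le> (\<Sum>x\<leftarrow>X. Suc (w (f x))) + 2"
      using w_big(1)[of "map f X"] by (simp add: comp_def)
    \<comment> \<open>The overhead of 2 is the closing \<top> and the outer \<open>Suc\<close>; a
      premise or a formula of \<open>A\<close> pays for it.\<close>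
    moreover have "2 \<le> 2 * length X + 2 * size A"
      using False by (cases X; cases A) auto
    ultimately show ?thesis by linarith
  qed
  ultimately show ?thesis
    using lang by (intro exI[of _ "[?D]"]) (auto simp: group_interpolant_def intro: fusible_single)
qed

lemma ex_groups_interpolant:
  assumes "\<forall>g\<in>I. langs L (A g)"
    and "\<forall>g\<in>I. \<forall>(\<psi>, \<theta>)\<in>set (X g). interpolable \<beta> (A g + B g + \<psi> \<Rightarrow>\<^sub>s \<theta>)"
  shows "\<exists>Ds. \<forall>g\<in>I. group_interpolant \<beta> (A g) (B g) (X g) (Ds g)"
  using assms by (intro bchoice ballI ex_group_interpolant) auto

lemma w_big_fus_concat:
  assumes "distinct gs"
  shows "w (big_fus (concat (map Ds gs))) \<le> (\<Sum>g\<in>set gs. \<Sum>D\<leftarrow>Ds g. Suc (w D)) + 1"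
proof -
  have "(\<Sum>D\<leftarrow>concat (map Ds gs). Suc (w D)) = (\<Sum>g\<in>set gs. \<Sum>D\<leftarrow>Ds g. Suc (w D))"
    using assms by (induction gs) auto
  then show ?thesis using w_big(3)[of "concat (map Ds gs)"] by simp
qed

end

text \<open>Here the variable conditions of semi-analytic rules take effect: premises bring no atoms
  beyond those of their context and the principal formula, except that main premises also carry
  \<open>D\<close>.\<close>

lemma Vs_prems_subset:
  assumes "grouped r gs \<Phi> \<Theta>" and "g \<in> set gs"
  shows "(\<psi>, \<theta>) \<in> set (side_prems \<sigma> g) \<Longrightarrow>
      Vs \<psi> \<union> Vs \<theta> \<subseteq> Vs (inst_mset \<sigma> \<Phi>) \<union> Vs (inst_mset \<sigma> \<Theta>)"
    and "\<phi>s \<in> set (main_prems \<sigma> g) \<Longrightarrow> Vs \<phi>s \<subseteq> Vs (inst_mset \<sigma> \<Phi>) \<union> Vs (inst_mset \<sigma> \<Theta>)"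
    and "(\<psi>, \<theta>) \<in> set (all_prems \<sigma> D g) \<Longrightarrow>
      Vs \<psi> \<union> Vs \<theta> \<subseteq> Vs (inst_mset \<sigma> \<Phi>) \<union> Vs (inst_mset \<sigma> \<Theta>) \<union> Vs D"
proof -
  have *: "Vs (inst_mset \<sigma> M) \<subseteq> Vs (inst_mset \<sigma> \<Phi>) \<union> Vs (inst_mset \<sigma> \<Theta>)"
    if "Vs M \<subseteq> Vs (\<Phi> + \<Theta>)" for M
    using Vs_inst_form_mono[OF that, of \<sigma>] by simp
  have g: "\<forall>(\<psi>s, \<theta>s)\<in>set (side g). Vs \<psi>s \<union> Vs \<theta>s \<subseteq> Vs (\<Phi> + \<Theta>)"
    "\<forall>\<phi>s\<in>set (main g). Vs \<phi>s \<subseteq> Vs (\<Phi> + \<Theta>)"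
    using assms unfolding grouped_def by blast+
  show 1: "Vs \<psi> \<union> Vs \<theta> \<subseteq> Vs (inst_mset \<sigma> \<Phi>) \<union> Vs (inst_mset \<sigma> \<Theta>)"
    if mem: "(\<psi>, \<theta>) \<in> set (side_prems \<sigma> g)" for \<psi> \<theta>
  proof -
    obtain \<psi>' \<theta>' where "(\<psi>', \<theta>') \<in> set (side g)" "\<psi> = inst_mset \<sigma> \<psi>'" "\<theta> = inst_mset \<sigma> \<theta>'"
      using mem by (auto simp: side_prems_def)
    moreover from this g(1) have "Vs \<psi>' \<subseteq> Vs (\<Phi> + \<Theta>)" "Vs \<theta>' \<subseteq> Vs (\<Phi> + \<Theta>)" by auto
    ultimately show ?thesis using *[of \<psi>'] *[of \<theta>'] by simp
  qed
  show 2: "Vs \<phi>s \<subseteq> Vs (inst_mset \<sigma> \<Phi>) \<union> Vs (inst_mset \<sigma> \<Theta>)"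
    if mem: "\<phi>s \<in> set (main_prems \<sigma> g)" for \<phi>s
  proof -
    obtain \<phi>' where "\<phi>' \<in> set (main g)" "\<phi>s = inst_mset \<sigma> \<phi>'"
      using mem by (auto simp: main_prems_def)
    then show ?thesis using *[of \<phi>'] g(2) by simp
  qed
  show "(\<psi>, \<theta>) \<in> set (all_prems \<sigma> D g) \<Longrightarrow>
      Vs \<psi> \<union> Vs \<theta> \<subseteq> Vs (inst_mset \<sigma> \<Phi>) \<union> Vs (inst_mset \<sigma> \<Theta>) \<union> Vs D"
    using 1[of \<psi> \<theta>] 2[of \<psi>] unfolding all_prems_def by auto
qed

locale FLe_axiomatic_extension = FLe_interpolation L H w
  for L :: "'c conn set" and H :: "'c calculus" and w :: "'c form \<Rightarrow> nat" +
  fixes G :: "'c calculus" and R :: "'c rule set"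
  assumes H_eq: "H = AxExt G R"
begin

lemma prv_rule:
  assumes "r \<in> R" and "\<forall>n. in_lang L (\<sigma> n)" and "\<forall>n. langs L (\<mu> n)"
    and "\<forall>P\<in>#prems r. provable L H (inst_seq \<sigma> \<mu> P)"
    and "size (succ (inst_seq \<sigma> \<mu> (concl r))) \<le> 1"
  shows "provable L H (inst_seq \<sigma> \<mu> (concl r))"
proof -
  have "admissible L H r"
    using assms(1) unfolding admissible_def H_eq provable_AxExt by (auto intro: derivable.rule)
  from admissibleD[OF this assms(2,3) lang_H assms(4)] assms(5) show ?thesis
    by (simp add: single_conclusion_def)
qed

text \<open>The substitute for cut. The instance keeps \<open>\<sigma>\<close>, hence its principal
  and auxiliary formulas, while contexts and succedents are replaced at will; interpolants enter the
  rule through these places.\<close>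

lemma prv_grouped:
  assumes "r \<in> R" and "grouped r gs \<Phi> \<Theta>" and "\<forall>n. in_lang L (\<sigma> n)"
    and "\<And>g. g \<in> set gs \<Longrightarrow> langs L (M g)" "\<And>g. g \<in> set gs \<Longrightarrow> langs L (D g)"
    and "\<And>g. g \<in> set gs \<Longrightarrow> gsuc g = None \<Longrightarrow> D g = {#}"
    and "\<And>g \<psi> \<theta>. g \<in> set gs \<Longrightarrow> (\<psi>, \<theta>) \<in> set (all_prems \<sigma> (D g) g) \<Longrightarrow> M g + \<psi> \<turnstile> \<theta>"
    and "size ((\<Sum>g\<in>set gs. D g) + inst_mset \<sigma> \<Theta>) \<le> 1"
  shows "(\<Sum>g\<in>set gs. M g) + inst_mset \<sigma> \<Phi> \<turnstile> (\<Sum>g\<in>set gs. D g) + inst_mset \<sigma> \<Theta>"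
proof -
  obtain \<mu> where \<mu>: "\<forall>n. langs L (\<mu> n)"
    "\<forall>g\<in>set gs. \<mu> (gctx g) = M g \<and> (case gsuc g of None \<Rightarrow> {#} | Some d \<Rightarrow> \<mu> d) = D g"
    using ex_context_assignment[OF assms(2), of M L D] assms(4-6) by blast
  note inst = inst_grouped[OF assms(2) \<mu>(2), of \<sigma>]
  have "\<forall>P\<in>#image_mset (inst_seq \<sigma> \<mu>) (prems r). provable L H P"
    unfolding inst(1) using assms(7) by (auto simp: set_mset_sum)
  then show ?thesis
    using prv_rule[OF assms(1,3) \<mu>(1)] assms(8) inst(2) by auto
qed

text \<open>The auxiliary formulas are on the side of \<Lambda> and the succedent, as is the
  principal formula, so each \<Sigma>-part \<open>A g\<close> can give way to \<open>Ds g\<close> in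
  the rule. The final 1 in the bound is the unit of the fusion.\<close>

lemma interpolant_principal_right:
  assumes r: "r \<in> R" "grouped r gs \<Phi> \<Theta>" "\<forall>n. in_lang L (\<sigma> n)"
    and langs: "\<And>g. g \<in> set gs \<Longrightarrow> langs L (A g + B g)" "\<And>g. g \<in> set gs \<Longrightarrow> langs L (D g)"
    and none: "\<And>g. g \<in> set gs \<Longrightarrow> gsuc g = None \<Longrightarrow> D g = {#}"
    and itp: "\<forall>g\<in>set gs. \<forall>(\<psi>, \<theta>)\<in>set (all_prems \<sigma> (D g) g). interpolable \<beta> (A g + B g + \<psi> \<Rightarrow>\<^sub>s \<theta>)"
    and size: "size ((\<Sum>g\<in>set gs. D g) + inst_mset \<sigma> \<Theta>) \<le> 1"
  shows "\<exists>C. interpolant L H (\<Sum>g\<in>set gs. A g) ((\<Sum>g\<in>set gs. B g) + inst_mset \<sigma> \<Phi>)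
      ((\<Sum>g\<in>set gs. D g) + inst_mset \<sigma> \<Theta>) C \<and>
    w C \<le> (\<Sum>g\<in>set gs. (\<Sum>(\<psi>, \<theta>)\<leftarrow>all_prems \<sigma> (D g) g. \<beta> (A g + B g + \<psi> \<Rightarrow>\<^sub>s \<theta>) + 3) +
      2 * size (A g)) + 1"
proof -
  have d: "distinct gs" using r(2) by (auto simp: grouped_def distinct_map)
  obtain Ds where
    "\<forall>g\<in>set gs. group_interpolant \<beta> (A g) (B g) (all_prems \<sigma> (D g) g) (Ds g)"
    using ex_groups_interpolant[of "set gs" A "\<lambda>g. all_prems \<sigma> (D g) g" \<beta> B] langs itp by auto
  note Ds = group_interpolantD[OF bspec[OF this]]
  let ?E = "concat (map Ds gs)" let ?C = "big_fus ?E"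
  have "(\<Sum>g\<in>set gs. mset (Ds g) + B g) + inst_mset \<sigma> \<Phi> \<turnstile> (\<Sum>g\<in>set gs. D g) + inst_mset \<sigma> \<Theta>"
    using Ds langs none size by (intro prv_grouped[OF r]) auto
  then have "add_mset ?C ((\<Sum>g\<in>set gs. B g) + inst_mset \<sigma> \<Phi>) \<turnstile> (\<Sum>g\<in>set gs. D g) + inst_mset \<sigma> \<Theta>"
    by (intro prv_big_fusL) (simp add: mset_concat_distinct[OF d] sum.distrib add.assoc)
  moreover have "(\<Sum>g\<in>set gs. A g) \<turnstile> {#?C#}"
    using Ds(2) by (intro prv_big_fusR fusible_concat d) auto
  moreover have "V ?C \<subseteq> Vs (\<Sum>g\<in>set gs. A g) \<inter>
      Vs ((\<Sum>g\<in>set gs. B g) + inst_mset \<sigma> \<Phi> + ((\<Sum>g\<in>set gs. D g) + inst_mset \<sigma> \<Theta>))"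
  proof
    fix p assume "p \<in> V ?C"
    then obtain g where g: "g \<in> set gs" "p \<in> Vs (mset (Ds g))" by (auto simp: Vs_def)
    then have pA: "p \<in> Vs (A g)"
      and "p \<in> (\<Union>(\<psi>, \<theta>)\<in>set (all_prems \<sigma> (D g) g). Vs (B g + \<psi> + \<theta>))"
      using Ds(4)[OF g(1)] by blast+
    then obtain \<psi> \<theta> where x: "(\<psi>, \<theta>) \<in> set (all_prems \<sigma> (D g) g)" "p \<in> Vs (B g + \<psi> + \<theta>)"
      by auto
    have "p \<in> Vs (B g) \<union> Vs (inst_mset \<sigma> \<Phi>) \<union> Vs (inst_mset \<sigma> \<Theta>) \<union> Vs (D g)"
      using x(2) Vs_prems_subset(3)[OF r(2) g(1) x(1)] by auto
    then show "p \<in> Vs (\<Sum>g\<in>set gs. A g) \<inter>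
      Vs ((\<Sum>g\<in>set gs. B g) + inst_mset \<sigma> \<Phi> + ((\<Sum>g\<in>set gs. D g) + inst_mset \<sigma> \<Theta>))"
      using g(1) pA by (auto simp: Vs_sum)
  qed
  moreover have "w ?C \<le> (\<Sum>g\<in>set gs. (\<Sum>(\<psi>, \<theta>)\<leftarrow>all_prems \<sigma> (D g) g.
      \<beta> (A g + B g + \<psi> \<Rightarrow>\<^sub>s \<theta>) + 3) + 2 * size (A g)) + 1"
    using Ds(5) by (intro order.trans[OF w_big_fus_concat[OF d]] add_right_mono sum_mono)
  ultimately show ?thesis
    using Ds(1) by (intro exI[of _ ?C]) (auto simp: interpolant_def)
qed

text \<open>Without a succedent nothing prevents swapping both sides for all premises, which reduces
  this case to the previous one. Of the final 3, one comes from there and two pay for \<rightarrow>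
  and 0.\<close>

lemma interpolant_principal_left_empty:
  assumes r: "r \<in> R" "grouped r gs \<Phi> {#}" "\<forall>n. in_lang L (\<sigma> n)"
    and langs: "\<And>g. g \<in> set gs \<Longrightarrow> langs L (A g + B g)"
    and itp: "\<forall>g\<in>set gs. \<forall>(\<psi>, \<theta>)\<in>set (all_prems \<sigma> {#} g). interpolable \<beta> (B g + A g + \<psi> \<Rightarrow>\<^sub>s \<theta>)"
  shows "\<exists>C. interpolant L H ((\<Sum>g\<in>set gs. A g) + inst_mset \<sigma> \<Phi>) (\<Sum>g\<in>set gs. B g) {#} C \<and>
    w C \<le> (\<Sum>g\<in>set gs. (\<Sum>(\<psi>, \<theta>)\<leftarrow>all_prems \<sigma> {#} g. \<beta> (B g + A g + \<psi> \<Rightarrow>\<^sub>s \<theta>) + 3) +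
      2 * size (B g)) + 3"
proof -
  from interpolant_principal_right[OF r, of B A "\<lambda>_. {#}" \<beta>] langs itp obtain E where
    E: "interpolant L H (\<Sum>g\<in>set gs. B g) ((\<Sum>g\<in>set gs. A g) + inst_mset \<sigma> \<Phi>) {#} E"
    "w E \<le> (\<Sum>g\<in>set gs. (\<Sum>(\<psi>, \<theta>)\<leftarrow>all_prems \<sigma> {#} g. \<beta> (B g + A g + \<psi> \<Rightarrow>\<^sub>s \<theta>) + 3) +
      2 * size (B g)) + 1"
    by auto
  have "(\<Sum>g\<in>set gs. A g) + inst_mset \<sigma> \<Phi> \<turnstile> {#Imp E Zero#}"
    using E(1) by (auto simp: interpolant_def intro!: prv_ImpR prv_ZeroR)
  moreover have "add_mset (Imp E Zero) (\<Sum>g\<in>set gs. B g) \<turnstile> {#}"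
    using E(1) prv_ImpL[of "\<Sum>g\<in>set gs. B g" E Zero "{#}" "{#}"] prv_ZeroL
    by (simp add: interpolant_def)
  moreover have "w (Imp E Zero) \<le> w E + 2"
    using w_simps(8)[of E Zero] w_simps(2) by simp
  ultimately show ?thesis
    using E by (intro exI[of _ "Imp E Zero"]) (auto simp: interpolant_def)
qed

text \<open>Only the main premises of \<open>g0\<close> contain \<delta>; they keep their
  orientation and yield the disjunction, all others are swapped. Under \<open>mode\<close>, either
  \<open>g0\<close> has no swapped premises, or the additive implication rule and weakening are at
  hand.\<close>

lemma interpolant_principal_left:
  assumes r: "r \<in> R" "grouped r gs \<Phi> {#}" "\<forall>n. in_lang L (\<sigma> n)"
    and langs: "\<And>g. g \<in> set gs \<Longrightarrow> langs L (A g + B g)"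
    and g0: "g0 \<in> set gs" "gsuc g0 \<noteq> None" and \<delta>: "in_lang L \<delta>"
    and D: "D g0 = {#\<delta>#}" "\<And>g. g \<in> set gs \<Longrightarrow> g \<noteq> g0 \<Longrightarrow> D g = {#}"
    and itp: "\<forall>g\<in>set gs. \<forall>(\<psi>, \<theta>)\<in>set (all_prems \<sigma> (D g) g). interpolable \<beta> (B g + A g + \<psi> \<Rightarrow>\<^sub>s \<theta>)"
    and mode: "side g0 = [] \<or>
      admissible L H left_weakening \<and> admissible L H context_sharing_left_imp"
  shows "\<exists>C. interpolant L H ((\<Sum>g\<in>set gs. A g) + inst_mset \<sigma> \<Phi>) (\<Sum>g\<in>set gs. B g) {#\<delta>#} C \<and>
    w C \<le> (\<Sum>g\<in>set gs. (\<Sum>(\<psi>, \<theta>)\<leftarrow>all_prems \<sigma> (D g) g. \<beta> (B g + A g + \<psi> \<Rightarrow>\<^sub>s \<theta>) + 3) +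
      2 * size (B g)) + 3"
proof -
  have d: "distinct gs" using r(2) by (auto simp: grouped_def distinct_map)
  \<comment> \<open>The side premises of \<open>g0\<close> are absent in the multiplicative case, and then \<open>B g0\<close> must be
    saved for the right premise of \<open>L\<rightarrow>\<close>.\<close>
  define X where "X g = (if g = g0 then side_prems \<sigma> g0 else all_prems \<sigma> (D g) g)" for g
  define B' where "B' g = (if g = g0 \<and> side g0 = [] then {#} else B g)" for g
  have X_sub: "set (X g) \<subseteq> set (all_prems \<sigma> (D g) g)" for g
    by (auto simp: X_def all_prems_def)
  have "\<forall>g\<in>set gs. \<forall>(\<psi>, \<theta>)\<in>set (X g). interpolable \<beta> (B' g + A g + \<psi> \<Rightarrow>\<^sub>s \<theta>)"
  proof (intro ballI, clarify)
    fix g \<psi> \<theta> assume g: "g \<in> set gs" "(\<psi>, \<theta>) \<in> set (X g)"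
    then have "B' g = B g" by (auto simp: B'_def X_def side_prems_def)
    then show "interpolable \<beta> (B' g + A g + \<psi> \<Rightarrow>\<^sub>s \<theta>)" using itp g X_sub by fastforce
  qed
  moreover have "\<forall>g\<in>set gs. langs L (B' g)" using langs by (auto simp: B'_def)
  ultimately obtain Ds where
    "\<forall>g\<in>set gs. group_interpolant \<beta> (B' g) (A g) (X g) (Ds g)"
    using ex_groups_interpolant[of "set gs" B' X \<beta> A] by auto
  note Ds = group_interpolantD[OF bspec[OF this]]
  have "\<forall>\<phi>s\<in>set (main_prems \<sigma> g0). \<exists>C. interpolant L H (A g0 + \<phi>s) (B g0) {#\<delta>#} C \<and>
      w C \<le> \<beta> (B g0 + A g0 + \<phi>s \<Rightarrow>\<^sub>s {#\<delta>#})"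
  proof
    fix \<phi>s assume "\<phi>s \<in> set (main_prems \<sigma> g0)"
    then have "(\<phi>s, {#\<delta>#}) \<in> set (all_prems \<sigma> (D g0) g0)" by (simp add: all_prems_def D(1))
    then have "interpolable \<beta> (B g0 + A g0 + \<phi>s \<Rightarrow>\<^sub>s {#\<delta>#})" using itp g0(1) by fastforce
    moreover have "B g0 + A g0 + \<phi>s = (A g0 + \<phi>s) + B g0" by simp
    ultimately show "\<exists>C. interpolant L H (A g0 + \<phi>s) (B g0) {#\<delta>#} C \<and>
        w C \<le> \<beta> (B g0 + A g0 + \<phi>s \<Rightarrow>\<^sub>s {#\<delta>#})"
      unfolding interpolable_def by metis
  qed
  from bchoice[OF this] obtain f where
    f: "\<And>\<phi>s. \<phi>s \<in> set (main_prems \<sigma> g0) \<Longrightarrow> interpolant L H (A g0 + \<phi>s) (B g0) {#\<delta>#} (f \<phi>s)"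
    "\<And>\<phi>s. \<phi>s \<in> set (main_prems \<sigma> g0) \<Longrightarrow> w (f \<phi>s) \<le> \<beta> (B g0 + A g0 + \<phi>s \<Rightarrow>\<^sub>s {#\<delta>#})"
    by blast
  let ?Cs = "map f (main_prems \<sigma> g0)"
  let ?C = "big_or ?Cs" and ?E = "concat (map Ds gs)"
  let ?I = "Imp (big_fus ?E) ?C"
  have lang_Cs: "\<forall>C\<in>set ?Cs. in_lang L C" using f(1) by (auto simp: interpolant_def)
  \<comment> \<open>The rule will be applied with \<open>mset (Ds g0) + A g0\<close> as the context
    of \<open>g0\<close>, so its main premises must contain \<open>Ds g0\<close> as well.\<close>
  have main: "mset (Ds g0) + A g0 + \<phi>s \<turnstile> {#?C#}" if "\<phi>s \<in> set (main_prems \<sigma> g0)" for \<phi>s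
  proof -
    have "A g0 + \<phi>s \<turnstile> {#f \<phi>s#}" using f(1)[OF that] by (simp add: interpolant_def)
    then have *: "A g0 + \<phi>s \<turnstile> {#?C#}"
      using that lang_Cs by (intro prv_big_orR[of "f \<phi>s"]) auto
    show ?thesis
    proof (cases "side g0 = []")
      case True
      \<comment> \<open>With no premises in \<open>X g0\<close> and \<open>B' g0\<close> empty the
        length bound is 0, and since each member counts at least 1, even for the zero weight,
        \<open>Ds g0\<close> must be empty.\<close>
      then have "(\<Sum>D\<leftarrow>Ds g0. Suc (w D)) = 0"
        using Ds(5)[OF g0(1)] by (simp add: X_def B'_def side_prems_def)
      then have "Ds g0 = []" by (cases "Ds g0") auto
      then show ?thesis using * by simp
    next
      case False
      then have "A g0 + \<phi>s + mset (Ds g0) \<turnstile> {#?C#}"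
        using mode Ds(1)[OF g0(1)] by (intro prv_weaken *) auto
      then show ?thesis by (simp add: ac_simps)
    qed
  qed
  \<comment> \<open>The succedent of \<open>g0\<close> is schematic, so \<delta> may be replaced by
    the disjunction, which all main premises of \<open>g0\<close> now prove.\<close>
  define D' where "D' g = (if g = g0 then {#?C#} else {#})" for g
  have sum_D': "(\<Sum>g\<in>set gs. D' g) = {#?C#}"
    using g0(1) by (simp add: D'_def sum.remove)
  have "(\<Sum>g\<in>set gs. mset (Ds g) + A g) + inst_mset \<sigma> \<Phi> \<turnstile> (\<Sum>g\<in>set gs. D' g) + inst_mset \<sigma> {#}"
  proof (rule prv_grouped[OF r])
    show "mset (Ds g) + A g + \<psi> \<turnstile> \<theta>"
      if "g \<in> set gs" "(\<psi>, \<theta>) \<in> set (all_prems \<sigma> (D' g) g)" for g \<psi> \<theta>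
    proof (cases "g = g0")
      case True
      then show ?thesis
        using that main Ds(3)[OF g0(1), of \<psi> \<theta>] by (auto simp: all_prems_def D'_def X_def)
    next
      case False
      then show ?thesis using that Ds(3) by (simp add: X_def D'_def D(2))
    qed
  qed (use Ds(1) langs lang_Cs g0(2) sum_D' in \<open>auto simp: D'_def\<close>)
  then have "mset ?E + ((\<Sum>g\<in>set gs. A g) + inst_mset \<sigma> \<Phi>) \<turnstile> {#?C#}"
    by (simp add: mset_concat_distinct[OF d] sum.distrib sum_D' add.assoc)
  then have left: "(\<Sum>g\<in>set gs. A g) + inst_mset \<sigma> \<Phi> \<turnstile> {#?I#}"
    by (intro prv_ImpR prv_big_fusL)
  have fus: "(\<Sum>g\<in>set gs. B' g) \<turnstile> {#big_fus ?E#}"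
    using Ds(2) by (intro prv_big_fusR fusible_concat d) auto
  have C: "add_mset ?C (B g0) \<turnstile> {#\<delta>#}"
    using langs[OF g0(1)] f(1) \<delta> by (intro prv_big_orL) (auto simp: interpolant_def)
  have B_g0: "(\<Sum>g\<in>set gs. B g) = B g0 + (\<Sum>g\<in>set gs - {g0}. B g)"
    using g0(1) by (simp add: sum.remove)
  \<comment> \<open>Without side premises the other groups alone prove the fusion, and
    \<open>B g0\<close> is left for the disjunction. Otherwise the whole of \<Lambda> goes to both
    premises of the implication rule.\<close>
  have right: "add_mset ?I (\<Sum>g\<in>set gs. B g) \<turnstile> {#\<delta>#}"
  proof (cases "side g0 = []")
    case True
    then have "(\<Sum>g\<in>set gs. B' g) = (\<Sum>g\<in>set gs - {g0}. B g)"
      using g0(1) by (simp add: sum.remove B'_def)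
    then show ?thesis using prv_ImpL[OF fus C] B_g0 by (simp add: add.commute)
  next
    case False
    then have B': "B' = B" by (auto simp: B'_def)
    have "add_mset ?C (B g0) + (\<Sum>g\<in>set gs - {g0}. B g) \<turnstile> {#\<delta>#}"
      using False mode langs by (intro prv_weaken C) (auto simp: langs_sum)
    then show ?thesis
      using False mode fus B_g0 by (intro prv_ImpL_shared) (auto simp: B')
  qed
  have "V ?C \<subseteq> Vs ((\<Sum>g\<in>set gs. A g) + inst_mset \<sigma> \<Phi>) \<inter> Vs ((\<Sum>g\<in>set gs. B g) + {#\<delta>#})"
  proof
    fix p assume "p \<in> V ?C"
    then obtain \<phi>s where \<phi>s: "\<phi>s \<in> set (main_prems \<sigma> g0)" "p \<in> V (f \<phi>s)" by auto
    then have "p \<in> Vs (A g0 + \<phi>s)" "p \<in> Vs (B g0 + {#\<delta>#})"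
      using f(1)[OF \<phi>s(1)] by (auto simp: interpolant_def)
    then show "p \<in> Vs ((\<Sum>g\<in>set gs. A g) + inst_mset \<sigma> \<Phi>) \<inter> Vs ((\<Sum>g\<in>set gs. B g) + {#\<delta>#})"
      using g0(1) Vs_prems_subset(2)[OF r(2) g0(1) \<phi>s(1)] by (auto simp: Vs_sum)
  qed
  moreover have "V (big_fus ?E) \<subseteq>
    Vs ((\<Sum>g\<in>set gs. A g) + inst_mset \<sigma> \<Phi>) \<inter> Vs ((\<Sum>g\<in>set gs. B g) + {#\<delta>#})"
  proof
    fix p assume "p \<in> V (big_fus ?E)"
    then obtain g where g: "g \<in> set gs" "p \<in> Vs (mset (Ds g))" by (auto simp: Vs_def)
    then have "p \<in> Vs (B' g)" and "p \<in> (\<Union>(\<psi>, \<theta>)\<in>set (X g). Vs (A g + \<psi> + \<theta>))"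
      using Ds(4)[OF g(1)] by blast+
    then obtain \<psi> \<theta> where x: "(\<psi>, \<theta>) \<in> set (X g)" "p \<in> Vs (A g + \<psi> + \<theta>)" by auto
    have "p \<in> Vs (A g) \<union> Vs (inst_mset \<sigma> \<Phi>)"
    proof (cases "g = g0")
      case True
      then show ?thesis
        using x(2) Vs_prems_subset(1)[OF r(2) g0(1), of \<psi> \<theta> \<sigma>] x(1) by (auto simp: X_def)
    next
      case False
      then show ?thesis
        using x(2) Vs_prems_subset(3)[OF r(2) g(1), of \<psi> \<theta> \<sigma> "{#}"] x(1)
        by (auto simp: X_def D(2)[OF g(1)])
    qed
    moreover have "p \<in> Vs (B g)"
      using \<open>p \<in> Vs (B' g)\<close> by (auto simp: B'_def split: if_splits)
    ultimately show
      "p \<in> Vs ((\<Sum>g\<in>set gs. A g) + inst_mset \<sigma> \<Phi>) \<inter> Vs ((\<Sum>g\<in>set gs. B g) + {#\<delta>#})"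
      using g(1) by (auto simp: Vs_sum)
  qed
  moreover have "w ?I \<le> (\<Sum>g\<in>set gs. (\<Sum>(\<psi>, \<theta>)\<leftarrow>all_prems \<sigma> (D g) g.
      \<beta> (B g + A g + \<psi> \<Rightarrow>\<^sub>s \<theta>) + 3) + 2 * size (B g)) + 3"
  proof -
    let ?T = "\<lambda>g. (\<Sum>(\<psi>, \<theta>)\<leftarrow>all_prems \<sigma> (D g) g. \<beta> (B g + A g + \<psi> \<Rightarrow>\<^sub>s \<theta>) + 3) + 2 * size (B g)"
    let ?e = "\<lambda>g. \<Sum>D\<leftarrow>Ds g. Suc (w D)"
    let ?c = "\<Sum>\<phi>s\<leftarrow>main_prems \<sigma> g0. Suc (w (f \<phi>s))"
    have "?e g \<le> ?T g" if "g \<in> set gs - {g0}" for g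
      using that Ds(5)[of g] by (simp add: X_def B'_def)
    then have "(\<Sum>g\<in>set gs - {g0}. ?e g) \<le> (\<Sum>g\<in>set gs - {g0}. ?T g)"
      by (rule sum_mono)
    \<comment> \<open>The side premises of \<open>g0\<close> are charged to the fusion and its main
      premises to the disjunction, so none is charged twice. The final 3 of the bound stands for
      \<rightarrow>, 1 and \<bottom>.\<close>
    moreover have "?e g0 + ?c \<le> ?T g0"
    proof -
      have "?c \<le> (\<Sum>\<phi>s\<leftarrow>main_prems \<sigma> g0. \<beta> (B g0 + A g0 + \<phi>s \<Rightarrow>\<^sub>s {#\<delta>#}) + 3)"
        using f(2) by (intro sum_list_mono) fastforce
      moreover have "?e g0 \<le> (\<Sum>(\<psi>, \<theta>)\<leftarrow>side_prems \<sigma> g0. \<beta> (B g0 + A g0 + \<psi> \<Rightarrow>\<^sub>s \<theta>) + 3) +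
          2 * size (B g0)"
        using Ds(5)[OF g0(1)]
        by (cases "side g0 = []") (simp_all add: X_def B'_def side_prems_def)
      ultimately show ?thesis by (simp add: all_prems_def D(1) comp_def)
    qed
    moreover have "(\<Sum>g\<in>set gs. ?e g) = ?e g0 + (\<Sum>g\<in>set gs - {g0}. ?e g)"
      "(\<Sum>g\<in>set gs. ?T g) = ?T g0 + (\<Sum>g\<in>set gs - {g0}. ?T g)"
      using g0(1) by (simp_all add: sum.remove)
    moreover have "w ?I \<le> Suc (w (big_fus ?E) + w ?C)" by (rule w_simps)
    moreover have "w ?C \<le> ?c + 1" using w_big(2)[of ?Cs] by (simp add: comp_def)
    moreover have "w (big_fus ?E) \<le> (\<Sum>g\<in>set gs. ?e g) + 1" by (rule w_big_fus_concat[OF d])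
    ultimately show ?thesis by linarith
  qed
  ultimately show ?thesis
    using left right Ds(1) lang_Cs by (intro exI[of _ ?I]) (auto simp: interpolant_def)
qed

text \<open>The first alternative of \<open>mode\<close> says that no group has both swapped
  premises and a succedent, which is the situation where the multiplicative implication rule
  suffices.\<close>

lemma interpolable_grouped:
  assumes r: "r \<in> R" "grouped r gs \<Phi> \<Theta>"
    and principal: "\<Phi> = {#} \<or> (\<exists>\<phi>. \<Phi> = {#\<phi>#}) \<and> \<Theta> = {#}"
    and mode: "(\<forall>g\<in>set gs. side g = [] \<or> gsuc g = None) \<or>
      admissible L H left_weakening \<and> admissible L H context_sharing_left_imp"
    and inst: "rule_instance L r Ps (\<Sigma> + \<Lambda> \<Rightarrow>\<^sub>s \<Delta>)" and itp: "\<forall>P\<in>#Ps. interpolable \<beta> P"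
  shows "\<exists>C. interpolant L H \<Sigma> \<Lambda> \<Delta> C \<and> w C \<le> (\<Sum>P\<in>#Ps. \<beta> P + 3) + 2 * size (\<Sigma> + \<Lambda>) + 3"
proof -
  obtain \<sigma> \<mu> where \<sigma>: "\<forall>n. in_lang L (\<sigma> n)" and \<mu>: "\<forall>n. langs L (\<mu> n)"
    and Ps: "Ps = image_mset (inst_seq \<sigma> \<mu>) (prems r)"
    and S: "(\<Sigma> + \<Lambda> \<Rightarrow>\<^sub>s \<Delta>) = inst_seq \<sigma> \<mu> (concl r)" and sc: "size \<Delta> \<le> 1"
    using inst by (auto simp: rule_instance_def single_conclusion_def)
  define M where "M g = \<mu> (gctx g)" for g :: "'c grp"
  define D where "D g = (case gsuc g of None \<Rightarrow> {#} | Some d \<Rightarrow> \<mu> d)" for g :: "'c grp"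
  have M_D: "\<forall>g\<in>set gs. \<mu> (gctx g) = M g \<and> (case gsuc g of None \<Rightarrow> {#} | Some d \<Rightarrow> \<mu> d) = D g"
    by (simp add: M_def D_def)
  note ig = inst_grouped[OF r(2) M_D, of \<sigma>]
  have eq: "\<Sigma> + \<Lambda> = (\<Sum>g\<in>set gs. M g) + inst_mset \<sigma> \<Phi>" "\<Delta> = (\<Sum>g\<in>set gs. D g) + inst_mset \<sigma> \<Theta>"
    using S ig(2) by auto
  have langs: "langs L (M g)" "langs L (D g)" for g
    using \<mu> by (auto simp: M_def D_def split: option.splits)
  have none: "gsuc g = None \<Longrightarrow> D g = {#}" for g by (simp add: D_def)
  have itp_g: "\<forall>g\<in>set gs. \<forall>(\<psi>, \<theta>)\<in>set (all_prems \<sigma> (D g) g). interpolable \<beta> (M g + \<psi> \<Rightarrow>\<^sub>s \<theta>)"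
    using itp unfolding Ps ig(1) by (fastforce simp: set_mset_sum)
  let ?W = "\<Sum>g\<in>set gs. \<Sum>(\<psi>, \<theta>)\<leftarrow>all_prems \<sigma> (D g) g. \<beta> (M g + \<psi> \<Rightarrow>\<^sub>s \<theta>) + 3"
  have "(\<Sum>P\<in>#(\<Sum>g\<in>I. image_mset (\<lambda>(\<psi>, \<theta>). M g + \<psi> \<Rightarrow>\<^sub>s \<theta>) (mset (all_prems \<sigma> (D g) g))). \<beta> P + 3) =
      (\<Sum>g\<in>I. \<Sum>(\<psi>, \<theta>)\<leftarrow>all_prems \<sigma> (D g) g. \<beta> (M g + \<psi> \<Rightarrow>\<^sub>s \<theta>) + 3)" if "finite I" for I
    using that
    by (induction rule: finite_induct)
      (auto simp: multiset.map_comp comp_def case_prod_unfold simp flip: sum_mset_sum_list)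
  then have W: "(\<Sum>P\<in>#Ps. \<beta> P + 3) = ?W" unfolding Ps ig(1) by blast
  \<comment> \<open>The shares \<open>A g\<close> are separate pieces of the antecedent, so their
    charges add up to at most twice its size. The roles of \<open>A\<close> and \<open>B\<close> are
    exchanged when the principal formula is in \<Sigma>.\<close>
  have bound: "(\<Sum>g\<in>set gs. (\<Sum>(\<psi>, \<theta>)\<leftarrow>all_prems \<sigma> (D g) g. \<beta> (A g + B g + \<psi> \<Rightarrow>\<^sub>s \<theta>) + 3) +
      2 * size (A g)) \<le> (\<Sum>P\<in>#Ps. \<beta> P + 3) + 2 * size (\<Sigma> + \<Lambda>)" (is "?l \<le> _")
    if AB: "\<forall>g\<in>set gs. M g = A g + B g" and sub: "(\<Sum>g\<in>set gs. A g) \<subseteq># \<Sigma> + \<Lambda>" for A B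
  proof -
    have "(\<Sum>g\<in>set gs. size (A g)) \<le> size (\<Sigma> + \<Lambda>)"
      using size_mset_mono[OF sub] by (simp add: size_sum)
    moreover have "?l = ?W + 2 * (\<Sum>g\<in>set gs. size (A g))"
      unfolding sum_distrib_left sum.distrib[symmetric] using AB by (intro sum.cong) auto
    ultimately show ?thesis unfolding W by linarith
  qed
  \<comment> \<open>A left principal formula is a single occurrence and can be assigned to one side.
    For a right rule \<Phi> is empty and \<open>right\<close> holds, matching a succedent on the
    side of \<Lambda>.\<close>
  consider (right) "inst_mset \<sigma> \<Phi> \<subseteq># \<Lambda>" | (left) "inst_mset \<sigma> \<Phi> \<subseteq># \<Sigma>" "\<Theta> = {#}"
  proof (cases "\<Phi> = {#}")
    case False
    then obtain \<phi> where "\<Phi> = {#\<phi>#}" "\<Theta> = {#}" using principal by blast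
    moreover from this have "inst_form \<sigma> \<phi> \<in># \<Sigma> + \<Lambda>" using eq(1) by simp
    ultimately show ?thesis using that by auto
  qed (simp add: that)
  then show ?thesis
  proof cases
    case right
    define \<Lambda>' where "\<Lambda>' = \<Lambda> - inst_mset \<sigma> \<Phi>"
    have \<Lambda>: "\<Lambda> = \<Lambda>' + inst_mset \<sigma> \<Phi>" using right by (simp add: \<Lambda>'_def)
    then have "\<Sigma> + \<Lambda>' = (\<Sum>g\<in>set gs. M g)" using eq(1) by (simp add: add.assoc[symmetric])
    from multiset_sum_refine[OF _ this] obtain A B where
      AB: "\<forall>g\<in>set gs. M g = A g + B g" "\<Sigma> = (\<Sum>g\<in>set gs. A g)" "\<Lambda>' = (\<Sum>g\<in>set gs. B g)" by auto
    have "\<exists>C. interpolant L H (\<Sum>g\<in>set gs. A g) ((\<Sum>g\<in>set gs. B g) + inst_mset \<sigma> \<Phi>)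
        ((\<Sum>g\<in>set gs. D g) + inst_mset \<sigma> \<Theta>) C \<and>
      w C \<le> (\<Sum>g\<in>set gs. (\<Sum>(\<psi>, \<theta>)\<leftarrow>all_prems \<sigma> (D g) g. \<beta> (A g + B g + \<psi> \<Rightarrow>\<^sub>s \<theta>) + 3) +
        2 * size (A g)) + 1"
    proof (rule interpolant_principal_right[OF r \<sigma>])
      show "langs L (A g + B g)" if "g \<in> set gs" for g using langs(1)[of g] AB(1) that by simp
      show "\<forall>g\<in>set gs. \<forall>(\<psi>, \<theta>)\<in>set (all_prems \<sigma> (D g) g). interpolable \<beta> (A g + B g + \<psi> \<Rightarrow>\<^sub>s \<theta>)"
        using itp_g AB(1) by simp
      show "size ((\<Sum>g\<in>set gs. D g) + inst_mset \<sigma> \<Theta>) \<le> 1" using sc eq(2) by simp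
    qed (rule langs(2), rule none)
    then obtain C where C: "interpolant L H \<Sigma> \<Lambda> \<Delta> C"
      "w C \<le> (\<Sum>g\<in>set gs. (\<Sum>(\<psi>, \<theta>)\<leftarrow>all_prems \<sigma> (D g) g. \<beta> (A g + B g + \<psi> \<Rightarrow>\<^sub>s \<theta>) + 3) +
        2 * size (A g)) + 1"
      unfolding eq(2) \<Lambda> AB(3) unfolding AB(2) by blast
    then show ?thesis
      using bound[OF AB(1)] AB(2) by (intro exI[of _ C] conjI) simp_all
  next
    case left
    define \<Sigma>' where "\<Sigma>' = \<Sigma> - inst_mset \<sigma> \<Phi>"
    have \<Sigma>: "\<Sigma> = \<Sigma>' + inst_mset \<sigma> \<Phi>" using left(1) by (simp add: \<Sigma>'_def)
    then have "\<Sigma>' + \<Lambda> = (\<Sum>g\<in>set gs. M g)" using eq(1) by (simp add: ac_simps)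
    from multiset_sum_refine[OF _ this] obtain A B where
      AB: "\<forall>g\<in>set gs. M g = A g + B g" "\<Sigma>' = (\<Sum>g\<in>set gs. A g)" "\<Lambda> = (\<Sum>g\<in>set gs. B g)" by auto
    have BA: "\<forall>g\<in>set gs. M g = B g + A g" using AB(1) by (simp add: add.commute)
    note r' = r[unfolded left(2)]
    have bound': "(\<Sum>g\<in>set gs. (\<Sum>(\<psi>, \<theta>)\<leftarrow>all_prems \<sigma> (D g) g. \<beta> (B g + A g + \<psi> \<Rightarrow>\<^sub>s \<theta>) + 3) +
      2 * size (B g)) \<le> (\<Sum>P\<in>#Ps. \<beta> P + 3) + 2 * size (\<Sigma> + \<Lambda>)"
      using bound[OF BA] AB(3) by simp
    show ?thesis
    proof (cases "\<Delta> = {#}")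
      case True
      then have D0: "\<forall>g\<in>set gs. D g = {#}" using eq(2) left(2) by (simp add: sum_eq_empty_iff)
      have "\<exists>C. interpolant L H ((\<Sum>g\<in>set gs. A g) + inst_mset \<sigma> \<Phi>) (\<Sum>g\<in>set gs. B g) {#} C \<and>
        w C \<le> (\<Sum>g\<in>set gs. (\<Sum>(\<psi>, \<theta>)\<leftarrow>all_prems \<sigma> {#} g. \<beta> (B g + A g + \<psi> \<Rightarrow>\<^sub>s \<theta>) + 3) +
        2 * size (B g)) + 3"
      proof (rule interpolant_principal_left_empty[OF r' \<sigma>])
        show "langs L (A g + B g)" if "g \<in> set gs" for g using langs(1)[of g] AB(1) that by simp
        show "\<forall>g\<in>set gs. \<forall>(\<psi>, \<theta>)\<in>set (all_prems \<sigma> {#} g). interpolable \<beta> (B g + A g + \<psi> \<Rightarrow>\<^sub>s \<theta>)"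
          using itp_g BA D0 by simp
      qed
      then obtain C where "interpolant L H \<Sigma> \<Lambda> \<Delta> C"
        "w C \<le> (\<Sum>g\<in>set gs. (\<Sum>(\<psi>, \<theta>)\<leftarrow>all_prems \<sigma> (D g) g. \<beta> (B g + A g + \<psi> \<Rightarrow>\<^sub>s \<theta>) + 3) +
        2 * size (B g)) + 3"
        using D0 unfolding True \<Sigma> AB(2,3) by auto
      then show ?thesis using bound' by (intro exI[of _ C] conjI) simp_all
    next
      case False
      then obtain \<delta> where \<delta>: "\<Delta> = {#\<delta>#}" using sc
        by (metis One_nat_def le_Suc_eq le_zero_eq size_eq_0_iff_empty size_1_singleton_mset)
      then have D\<delta>: "(\<Sum>g\<in>set gs. D g) = {#\<delta>#}" using eq(2) left(2) by simp
      then obtain g0 where g0: "g0 \<in> set gs" "\<delta> \<in># D g0"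
        using set_mset_sum[of "set gs" D] by auto
      have "D g0 + (\<Sum>g\<in>set gs - {g0}. D g) = {#\<delta>#}"
        using D\<delta> g0(1) by (simp add: sum.remove)
      with g0(2) have D0: "D g0 = {#\<delta>#}" "(\<Sum>g\<in>set gs - {g0}. D g) = {#}"
        by (auto simp: union_is_single)
      have "\<exists>C. interpolant L H ((\<Sum>g\<in>set gs. A g) + inst_mset \<sigma> \<Phi>) (\<Sum>g\<in>set gs. B g) {#\<delta>#} C \<and>
        w C \<le> (\<Sum>g\<in>set gs. (\<Sum>(\<psi>, \<theta>)\<leftarrow>all_prems \<sigma> (D g) g. \<beta> (B g + A g + \<psi> \<Rightarrow>\<^sub>s \<theta>) + 3) +
        2 * size (B g)) + 3"
      proof (rule interpolant_principal_left[OF r' \<sigma>, where D = D])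
        show "g0 \<in> set gs" "D g0 = {#\<delta>#}" by fact+
        show "gsuc g0 \<noteq> None" using none g0(2) by (metis empty_iff set_mset_empty)
        then show "side g0 = [] \<or>
            admissible L H left_weakening \<and> admissible L H context_sharing_left_imp"
          using mode g0(1) by auto
        show "in_lang L \<delta>" using langs(2)[of g0] D0(1) by simp
        show "\<forall>g\<in>set gs. \<forall>(\<psi>, \<theta>)\<in>set (all_prems \<sigma> (D g) g). interpolable \<beta> (B g + A g + \<psi> \<Rightarrow>\<^sub>s \<theta>)"
          using itp_g BA by simp
        show "langs L (A g + B g)" if "g \<in> set gs" for g using langs(1)[of g] AB(1) that by simp
        show "D g = {#}" if "g \<in> set gs" "g \<noteq> g0" for g using D0(2) that by (simp add: sum_eq_empty_iff)
      qed
      then obtain C where "interpolant L H \<Sigma> \<Lambda> \<Delta> C"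
        "w C \<le> (\<Sum>g\<in>set gs. (\<Sum>(\<psi>, \<theta>)\<leftarrow>all_prems \<sigma> (D g) g. \<beta> (B g + A g + \<psi> \<Rightarrow>\<^sub>s \<theta>) + 3) +
        2 * size (B g)) + 3"
        unfolding \<delta> \<Sigma> AB(2,3) by blast
      then show ?thesis using bound' by (intro exI[of _ C] conjI) simp_all
    qed
  qed
qed

section \<open>Modal rules\<close>

lemma rule_in_lang_R: "r \<in> R \<Longrightarrow> rule_in_lang L r"
  using lang_H by (simp add: H_eq)

lemma prv_K:
  assumes "r \<in> R" "rule_K r" and "N \<turnstile> {#\<phi>#}"
  shows "image_mset Box N \<turnstile> {#Box \<phi>#}"
  using assms prvD[OF assms(3)] prv_rule[OF assms(1), of "\<lambda>_. \<phi>" "\<lambda>_. N"]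
  by (auto simp: rule_K_def inst_seq_def)

lemma prv_D:
  assumes "r \<in> R" "rule_D r" and "N \<turnstile> {#}"
  shows "image_mset Box N \<turnstile> {#}"
  using assms prvD[OF assms(3)] prv_rule[OF assms(1), of "\<lambda>_. One" "\<lambda>_. N"]
  by (auto simp: rule_D_def inst_seq_def)

lemma prv_RS4:
  assumes "r \<in> R" "rule_RS4 r" and "image_mset Box N \<turnstile> {#\<phi>#}"
  shows "image_mset Box N \<turnstile> {#Box \<phi>#}"
  using assms prvD[OF assms(3)] prv_rule[OF assms(1), of "\<lambda>_. \<phi>" "\<lambda>_. N"]
  by (auto simp: rule_RS4_def inst_seq_def)

lemma prv_LS4:
  assumes "r \<in> R" "rule_LS4 r" and "add_mset \<phi> \<Gamma> \<turnstile> \<Delta>"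
  shows "add_mset (Box \<phi>) \<Gamma> \<turnstile> \<Delta>"
proof -
  obtain c d n where r: "c \<noteq> d" "r = Rule {#{#Ctx c, MF (Var (MForm n))#} \<Rightarrow>\<^sub>s {#Ctx d#}#}
       ({#Ctx c, MF (Box (Var (MForm n)))#} \<Rightarrow>\<^sub>s {#Ctx d#})"
    using assms(2) by (auto simp: rule_LS4_def)
  show ?thesis
    using assms(3) r(1) prvD[OF assms(3)]
      prv_rule[OF assms(1), of "\<lambda>_. \<phi>" "\<lambda>m. if m = c then \<Gamma> else \<Delta>"]
    by (simp add: r(2) inst_seq_def)
qed

lemma prv_4:
  assumes "r \<in> R" "rule_4 r" and "image_mset Box N + N \<turnstile> {#\<phi>#}"
  shows "image_mset Box N \<turnstile> {#Box \<phi>#}"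
  using assms prvD[OF assms(3)] prv_rule[OF assms(1), of "\<lambda>_. \<phi>" "\<lambda>_. N"]
  by (auto simp: rule_4_def inst_seq_def)

lemma prv_4D:
  assumes "r \<in> R" "rule_4D r" and "image_mset Box N + N \<turnstile> {#}"
  shows "image_mset Box N \<turnstile> {#}"
  using assms prvD[OF assms(3)] prv_rule[OF assms(1), of "\<lambda>_. One" "\<lambda>_. N"]
  by (auto simp: rule_4D_def inst_seq_def)

text \<open>The map \<open>F\<close> sends a context \<open>\<Gamma>\<close> to its form \<open>\<Gamma>\<close>, \<open>\<box>\<Gamma>\<close> or \<open>\<box>\<Gamma>, \<Gamma>\<close> in the premise.\<close>

lemma ex_interpolant_modal:
  fixes F :: "'c form multiset \<Rightarrow> 'c form multiset"
  assumes "BoxC \<in> L" and F: "\<And>M N. F (M + N) = F M + F N" "\<And>N. Vs (F N) = Vs N"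
    and box: "\<And>N \<phi>. F N \<turnstile> {#\<phi>#} \<Longrightarrow> image_mset Box N \<turnstile> {#Box \<phi>#}"
    and box': "\<And>N \<phi>. add_mset \<phi> (F N) \<turnstile> \<theta> \<Longrightarrow> image_mset Box (add_mset \<phi> N) \<turnstile> \<theta>'"
    and \<theta>: "Vs \<theta>' = Vs \<theta>" and N: "\<Sigma> + \<Lambda> = image_mset Box N"
    and itp: "interpolable \<beta> (F N \<Rightarrow>\<^sub>s \<theta>)"
  shows "\<exists>C. interpolant L H \<Sigma> \<Lambda> \<theta>' C \<and> w C \<le> \<beta> (F N \<Rightarrow>\<^sub>s \<theta>) + 1"
proof -
  obtain M1 M2 where M: "N = M1 + M2" "\<Sigma> = image_mset Box M1" "\<Lambda> = image_mset Box M2"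
    using image_mset_eq_plusD[OF N[symmetric]] by blast
  obtain C where C: "interpolant L H (F M1) (F M2) \<theta> C" "w C \<le> \<beta> (F N \<Rightarrow>\<^sub>s \<theta>)"
    using itp F(1) M(1) unfolding interpolable_def by metis
  have "image_mset Box M1 \<turnstile> {#Box C#}" "add_mset (Box C) (image_mset Box M2) \<turnstile> \<theta>'"
    using C(1) box[of M1 C] box'[of C M2] by (auto simp: interpolant_def)
  then have "interpolant L H \<Sigma> \<Lambda> \<theta>' (Box C)"
    using C(1) assms(1) F(2) \<theta> by (auto simp: interpolant_def M)
  moreover have "w (Box C) \<le> \<beta> (F N \<Rightarrow>\<^sub>s \<theta>) + 1"
    using C(2) w_simps(9)[of C] by simp
  ultimately show ?thesis by blast
qed

text \<open>The interface between single rules and the induction on proofs. It holds for all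
  \<beta>, since \<beta> will be read off the subproofs at each node.\<close>

definition interpolating_rule :: "'c rule \<Rightarrow> bool" where
  "interpolating_rule r \<longleftrightarrow> (\<forall>\<beta> Ps \<Sigma> \<Lambda> \<Delta>.
     rule_instance L r Ps (\<Sigma> + \<Lambda> \<Rightarrow>\<^sub>s \<Delta>) \<longrightarrow> (\<forall>P\<in>#Ps. interpolable \<beta> P) \<longrightarrow>
     (\<exists>C. interpolant L H \<Sigma> \<Lambda> \<Delta> C \<and> w C \<le> (\<Sum>P\<in>#Ps. \<beta> P + 3) + 2 * size (\<Sigma> + \<Lambda>) + 3))"

lemma interpolating_rule_grouped:
  assumes "r \<in> R" "grouped r gs \<Phi> \<Theta>" "\<Phi> = {#} \<or> (\<exists>\<phi>. \<Phi> = {#\<phi>#}) \<and> \<Theta> = {#}"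
    and "(\<forall>g\<in>set gs. side g = [] \<or> gsuc g = None) \<or>
      admissible L H left_weakening \<and> admissible L H context_sharing_left_imp"
  shows "interpolating_rule r"
  unfolding interpolating_rule_def using interpolable_grouped[OF assms] by blast

lemma interpolating_rule_K:
  assumes "r \<in> R" "rule_K r"
  shows "interpolating_rule r"
  unfolding interpolating_rule_def
proof (intro allI impI)
  fix \<beta> Ps \<Sigma> \<Lambda> \<Delta>
  assume "rule_instance L r Ps (\<Sigma> + \<Lambda> \<Rightarrow>\<^sub>s \<Delta>)" and itp: "\<forall>P\<in>#Ps. interpolable \<beta> P"
  then obtain N \<phi> where eq: "Ps = {#N \<Rightarrow>\<^sub>s {#\<phi>#}#}" "\<Sigma> + \<Lambda> = image_mset Box N" "\<Delta> = {#Box \<phi>#}"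
    using assms(2) by (auto simp: rule_K_def rule_instance_def inst_seq_def)
  have "BoxC \<in> L" using rule_in_lang_R[OF assms(1)] assms(2) by (auto simp: rule_K_def rule_in_lang_def)
  moreover have "image_mset Box (add_mset \<psi> N) \<turnstile> {#Box \<phi>#}" if "add_mset \<psi> N \<turnstile> {#\<phi>#}" for N \<psi>
    using that by (rule prv_K[OF assms])
  ultimately have "\<exists>C. interpolant L H \<Sigma> \<Lambda> \<Delta> C \<and> w C \<le> \<beta> (N \<Rightarrow>\<^sub>s {#\<phi>#}) + 1"
    using itp eq prv_K[OF assms] by (intro ex_interpolant_modal[where F = "\<lambda>N. N"]) auto
  then show "\<exists>C. interpolant L H \<Sigma> \<Lambda> \<Delta> C \<and>
      w C \<le> (\<Sum>P\<in>#Ps. \<beta> P + 3) + 2 * size (\<Sigma> + \<Lambda>) + 3"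
    unfolding eq(1) by force
qed

text \<open>The half that proves \<open>Box C\<close> has a succedent, hence the need for
  \<open>K\<close>; the half that uses \<open>Box C\<close> is closed by \<open>D\<close>.\<close>

lemma interpolating_rule_D:
  assumes "r \<in> R" "rule_D r" and "k \<in> R" "rule_K k"
  shows "interpolating_rule r"
  unfolding interpolating_rule_def
proof (intro allI impI)
  fix \<beta> Ps \<Sigma> \<Lambda> \<Delta>
  assume "rule_instance L r Ps (\<Sigma> + \<Lambda> \<Rightarrow>\<^sub>s \<Delta>)" and itp: "\<forall>P\<in>#Ps. interpolable \<beta> P"
  then obtain N where eq: "Ps = {#N \<Rightarrow>\<^sub>s {#}#}" "\<Sigma> + \<Lambda> = image_mset Box N" "\<Delta> = {#}"
    using assms(2) by (auto simp: rule_D_def rule_instance_def inst_seq_def)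
  have "BoxC \<in> L" using rule_in_lang_R[OF assms(1)] assms(2) by (auto simp: rule_D_def rule_in_lang_def)
  moreover have "image_mset Box (add_mset \<psi> N) \<turnstile> {#}" if "add_mset \<psi> N \<turnstile> {#}" for N \<psi>
    using that by (rule prv_D[OF assms(1,2)])
  ultimately have "\<exists>C. interpolant L H \<Sigma> \<Lambda> \<Delta> C \<and> w C \<le> \<beta> (N \<Rightarrow>\<^sub>s {#}) + 1"
    using itp eq prv_K[OF assms(3,4)] by (intro ex_interpolant_modal[where F = "\<lambda>N. N"]) auto
  then show "\<exists>C. interpolant L H \<Sigma> \<Lambda> \<Delta> C \<and>
      w C \<le> (\<Sum>P\<in>#Ps. \<beta> P + 3) + 2 * size (\<Sigma> + \<Lambda>) + 3"
    unfolding eq(1) by force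
qed

text \<open>The interpolant of the premise is not boxed, so \<open>LS4\<close> has to box it before
  \<open>RS4\<close> applies to the half that uses it.\<close>

lemma interpolating_rule_RS4:
  assumes "r \<in> R" "rule_RS4 r" and "l \<in> R" "rule_LS4 l"
  shows "interpolating_rule r"
  unfolding interpolating_rule_def
proof (intro allI impI)
  fix \<beta> Ps \<Sigma> \<Lambda> \<Delta>
  assume "rule_instance L r Ps (\<Sigma> + \<Lambda> \<Rightarrow>\<^sub>s \<Delta>)" and itp: "\<forall>P\<in>#Ps. interpolable \<beta> P"
  then obtain N \<phi> where eq: "Ps = {#image_mset Box N \<Rightarrow>\<^sub>s {#\<phi>#}#}" "\<Sigma> + \<Lambda> = image_mset Box N"
    "\<Delta> = {#Box \<phi>#}"
    using assms(2) by (auto simp: rule_RS4_def rule_instance_def inst_seq_def)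
  have "BoxC \<in> L"
    using rule_in_lang_R[OF assms(1)] assms(2) by (auto simp: rule_RS4_def rule_in_lang_def)
  moreover have "image_mset Box (add_mset \<psi> N) \<turnstile> {#Box \<phi>#}"
    if "add_mset \<psi> (image_mset Box N) \<turnstile> {#\<phi>#}" for N \<psi>
    using prv_LS4[OF assms(3,4) that] by (intro prv_RS4[OF assms(1,2)]) simp
  ultimately have "\<exists>C. interpolant L H \<Sigma> \<Lambda> \<Delta> C \<and> w C \<le> \<beta> (image_mset Box N \<Rightarrow>\<^sub>s {#\<phi>#}) + 1"
    using itp eq prv_RS4[OF assms(1,2)]
    by (intro ex_interpolant_modal[where F = "image_mset Box"]) auto
  then show "\<exists>C. interpolant L H \<Sigma> \<Lambda> \<Delta> C \<and>
      w C \<le> (\<Sum>P\<in>#Ps. \<beta> P + 3) + 2 * size (\<Sigma> + \<Lambda>) + 3"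
    unfolding eq(1) by force
qed

text \<open>In the half that uses C the rule demands \<open>Box C\<close> next to C, and the boxed
  formula is supplied by weakening.\<close>

lemma interpolating_rule_4:
  assumes "r \<in> R" "rule_4 r" and weak: "admissible L H left_weakening_boxed"
  shows "interpolating_rule r"
  unfolding interpolating_rule_def
proof (intro allI impI)
  fix \<beta> Ps \<Sigma> \<Lambda> \<Delta>
  assume "rule_instance L r Ps (\<Sigma> + \<Lambda> \<Rightarrow>\<^sub>s \<Delta>)" and itp: "\<forall>P\<in>#Ps. interpolable \<beta> P"
  then obtain N \<phi> where eq: "Ps = {#image_mset Box N + N \<Rightarrow>\<^sub>s {#\<phi>#}#}" "\<Sigma> + \<Lambda> = image_mset Box N"
    "\<Delta> = {#Box \<phi>#}"
    using assms(2) by (auto simp: rule_4_def rule_instance_def inst_seq_def)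
  have Box: "BoxC \<in> L"
    using rule_in_lang_R[OF assms(1)] assms(2) by (auto simp: rule_4_def rule_in_lang_def)
  moreover have "image_mset Box (add_mset \<psi> N) \<turnstile> {#Box \<phi>#}"
    if "add_mset \<psi> (image_mset Box N + N) \<turnstile> {#\<phi>#}" for N \<psi>
    using prv_weaken_Box[OF weak Box that, of \<psi>] prvD[OF that]
    by (intro prv_4[OF assms(1,2)]) (simp add: add_mset_commute)
  ultimately have "\<exists>C. interpolant L H \<Sigma> \<Lambda> \<Delta> C \<and> w C \<le> \<beta> (image_mset Box N + N \<Rightarrow>\<^sub>s {#\<phi>#}) + 1"
    using itp eq prv_4[OF assms(1,2)]
    by (intro ex_interpolant_modal[where F = "\<lambda>N. image_mset Box N + N"]) auto
  then show "\<exists>C. interpolant L H \<Sigma> \<Lambda> \<Delta> C \<and>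
      w C \<le> (\<Sum>P\<in>#Ps. \<beta> P + 3) + 2 * size (\<Sigma> + \<Lambda>) + 3"
    unfolding eq(1) by force
qed

text \<open>As for \<open>D\<close>, the half that proves \<open>Box C\<close> has a succedent and
  is closed by rule \<open>4\<close>, the other one by \<open>4D\<close> after weakening by
  \<open>Box C\<close>.\<close>

lemma interpolating_rule_4D:
  assumes "r \<in> R" "rule_4D r" and "k \<in> R" "rule_4 k"
    and weak: "admissible L H left_weakening_boxed"
  shows "interpolating_rule r"
  unfolding interpolating_rule_def
proof (intro allI impI)
  fix \<beta> Ps \<Sigma> \<Lambda> \<Delta>
  assume "rule_instance L r Ps (\<Sigma> + \<Lambda> \<Rightarrow>\<^sub>s \<Delta>)" and itp: "\<forall>P\<in>#Ps. interpolable \<beta> P"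
  then obtain N where eq: "Ps = {#image_mset Box N + N \<Rightarrow>\<^sub>s {#}#}" "\<Sigma> + \<Lambda> = image_mset Box N"
    "\<Delta> = {#}"
    using assms(2) by (auto simp: rule_4D_def rule_instance_def inst_seq_def)
  have Box: "BoxC \<in> L"
    using rule_in_lang_R[OF assms(1)] assms(2) by (auto simp: rule_4D_def rule_in_lang_def)
  moreover have "image_mset Box (add_mset \<psi> N) \<turnstile> {#}"
    if "add_mset \<psi> (image_mset Box N + N) \<turnstile> {#}" for N \<psi>
    using prv_weaken_Box[OF weak Box that, of \<psi>] prvD[OF that]
    by (intro prv_4D[OF assms(1,2)]) (simp add: add_mset_commute)
  ultimately have "\<exists>C. interpolant L H \<Sigma> \<Lambda> \<Delta> C \<and> w C \<le> \<beta> (image_mset Box N + N \<Rightarrow>\<^sub>s {#}) + 1"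
    using itp eq prv_4[OF assms(3,4)]
    by (intro ex_interpolant_modal[where F = "\<lambda>N. image_mset Box N + N"]) auto
  then show "\<exists>C. interpolant L H \<Sigma> \<Lambda> \<Delta> C \<and>
      w C \<le> (\<Sum>P\<in>#Ps. \<beta> P + 3) + 2 * size (\<Sigma> + \<Lambda>) + 3"
    unfolding eq(1) by force
qed

end

section \<open>The kinds of semi-analytic schemes in grouped form\<close>

lemma left_semi_analytic_grouped:
  fixes r :: "'c rule"
  assumes "left_semi_analytic r"
  shows "\<exists>gs \<phi>. grouped r gs {#\<phi>#} {#} \<and> (\<forall>g\<in>set gs. side g = [] \<or> gsuc g = None)"
proof -
  obtain Ps :: "(nat \<times> ('c mform multiset \<times> 'c mform multiset) list) list"
    and Gs :: "(nat \<times> nat \<times> 'c mform multiset list) list" and \<phi> where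
    d: "distinct (map fst Ps @ map fst Gs @ map (fst \<circ> snd) Gs)" and
    v: "\<forall>(\<Pi>, prs)\<in>set Ps. \<forall>(\<psi>s, \<theta>s)\<in>set prs. Vs \<psi>s \<union> Vs \<theta>s \<subseteq> V \<phi>"
      "\<forall>(\<Gamma>, \<Delta>, \<phi>ss)\<in>set Gs. \<forall>\<phi>s\<in>set \<phi>ss. Vs \<phi>s \<subseteq> V \<phi>" and
    p: "prems r = mset (concat (map (\<lambda>(\<Pi>, prs). map (\<lambda>(\<psi>s, \<theta>s).
          add_mset (Ctx \<Pi>) (image_mset MF \<psi>s) \<Rightarrow>\<^sub>s image_mset MF \<theta>s) prs) Ps)) +
        mset (concat (map (\<lambda>(\<Gamma>, \<Delta>, \<phi>ss). map (\<lambda>\<phi>s.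
          add_mset (Ctx \<Gamma>) (image_mset MF \<phi>s) \<Rightarrow>\<^sub>s {#Ctx \<Delta>#}) \<phi>ss) Gs))" and
    c: "concl r =
        (mset (map (\<lambda>(\<Pi>, prs). Ctx \<Pi>) Ps) + mset (map (\<lambda>(\<Gamma>, \<Delta>, \<phi>ss). Ctx \<Gamma>) Gs) + {#MF \<phi>#}
         \<Rightarrow>\<^sub>s mset (map (\<lambda>(\<Gamma>, \<Delta>, \<phi>ss). Ctx \<Delta>) Gs))"
    using assms unfolding left_semi_analytic_def by blast
  \<comment> \<open>Each \<Pi>\<open>\<^sub>j\<close> becomes a group with side premises and no
    succedent, each \<Gamma>\<open>\<^sub>i\<close> a group with main premises only; thus no group
    mixes the two kinds.\<close>
  define f where "f = (\<lambda>(\<Pi>, prs :: ('c mform multiset \<times> 'c mform multiset) list). Grp \<Pi> None prs [])"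
  define h where "h = (\<lambda>(\<Gamma>, \<Delta>, \<phi>ss :: 'c mform multiset list). Grp \<Gamma> (Some \<Delta>) [] \<phi>ss)"
  have f: "gsuc (f x) = None" "gctx (f x) = fst x" for x
    by (simp_all add: f_def case_prod_unfold)
  have h: "gsuc (h x) = Some (fst (snd x))" "gctx (h x) = fst x" for x
    by (simp_all add: h_def case_prod_unfold)
  let ?gs = "map f Ps @ map h Gs"
  have ctx: "map gctx ?gs = map fst Ps @ map fst Gs"
    by (auto simp: f_def h_def)
  have dc: "distinct (map gctx ?gs)" unfolding ctx using d by auto
  then have dg: "distinct ?gs" unfolding distinct_map by blast
  have "inj_on (fst \<circ> snd) (set Gs)" "(fst \<circ> snd) ` set Gs \<inter> fst ` set Gs = {}"
    using d by (auto simp: distinct_map)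
  then have sep: "\<forall>x\<in>set Gs. \<forall>y\<in>set Gs. fst (snd x) \<noteq> fst y \<and> (fst (snd x) = fst (snd y) \<longrightarrow> x = y)"
    unfolding inj_on_def comp_def by blast
  have "(fst \<circ> snd) ` set Gs \<inter> fst ` set Ps = {}" using d by auto
  then have sep': "\<forall>x\<in>set Gs. \<forall>y\<in>set Ps. fst (snd x) \<noteq> fst y"
    unfolding comp_def by blast
  have "prems r = mset (concat (map grp_prems ?gs))"
    unfolding p by (simp add: f_def h_def grp_prems_def suc_items_def case_prod_unfold comp_def)
  moreover have suc: "(\<Sum>g\<in>set ?gs. suc_items g) = mset (map (\<lambda>(\<Gamma>, \<Delta>, \<phi>ss). Ctx \<Delta>) Gs)"
  proof -
    have "(\<Sum>g\<in>set ?gs. suc_items g) = (\<Sum>g\<leftarrow>?gs. suc_items g)"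
      using dg by (rule sum.distinct_set_conv_list)
    also have "\<dots> = (\<Sum>x\<leftarrow>Ps. {#}) + (\<Sum>(\<Gamma>, \<Delta>, \<phi>ss)\<leftarrow>Gs. {#Ctx \<Delta>#})"
      by (simp add: f_def h_def suc_items_def case_prod_unfold comp_def)
    also have "\<dots> = mset (map (\<lambda>(\<Gamma>, \<Delta>, \<phi>ss). Ctx \<Delta>) Gs)"
      by (induction Gs) auto
    finally show ?thesis .
  qed
  moreover have "\<forall>g\<in>set ?gs. \<forall>g'\<in>set ?gs. \<forall>d. gsuc g = Some d \<longrightarrow>
        d \<noteq> gctx g' \<and> (gsuc g' = Some d \<longrightarrow> g = g')"
    using sep sep' unfolding set_append set_map by (simp add: ball_Un f h) metis
  moreover have "\<forall>g\<in>set ?gs. (\<forall>(\<psi>s, \<theta>s)\<in>set (side g). Vs \<psi>s \<union> Vs \<theta>s \<subseteq> Vs ({#\<phi>#} + {#})) \<and>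
        (\<forall>\<phi>s\<in>set (main g). Vs \<phi>s \<subseteq> Vs ({#\<phi>#} + {#}))"
    using v by (fastforce simp: f_def h_def)
  moreover have ante: "mset (map (\<lambda>g. Ctx (gctx g)) ?gs) =
      mset (map (\<lambda>(\<Pi>, prs). Ctx \<Pi>) Ps) + mset (map (\<lambda>(\<Gamma>, \<Delta>, \<phi>ss). Ctx \<Gamma>) Gs)"
    by (simp add: f_def h_def case_prod_unfold multiset.map_comp comp_def)
  moreover have "concl r = (mset (map (\<lambda>g. Ctx (gctx g)) ?gs) + image_mset MF {#\<phi>#} \<Rightarrow>\<^sub>s
      (\<Sum>g\<in>set ?gs. suc_items g) + image_mset MF {#})"
    unfolding c suc ante by simp
  ultimately have "grouped r ?gs {#\<phi>#} {#}"
    using dc unfolding grouped_def by blast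
  moreover have "\<forall>g\<in>set ?gs. side g = [] \<or> gsuc g = None" by (auto simp: f_def h_def)
  ultimately show ?thesis by blast
qed

lemma right_semi_analytic_grouped:
  fixes r :: "'c rule"
  assumes "right_semi_analytic r"
  shows "\<exists>gs \<phi>. grouped r gs {#} {#\<phi>#} \<and> (\<forall>g\<in>set gs. gsuc g = None)"
proof -
  obtain Gs :: "(nat \<times> ('c mform multiset \<times> 'c mform multiset) list) list" and \<phi> where
    d: "distinct (map fst Gs)" and
    v: "\<forall>(\<Gamma>, prs)\<in>set Gs. \<forall>(\<phi>s, \<psi>s)\<in>set prs. Vs \<phi>s \<union> Vs \<psi>s \<subseteq> V \<phi>" and
    p: "prems r = mset (concat (map (\<lambda>(\<Gamma>, prs). map (\<lambda>(\<phi>s, \<psi>s).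
          add_mset (Ctx \<Gamma>) (image_mset MF \<phi>s) \<Rightarrow>\<^sub>s image_mset MF \<psi>s) prs) Gs))" and
    c: "concl r = (mset (map (\<lambda>(\<Gamma>, prs). Ctx \<Gamma>) Gs) \<Rightarrow>\<^sub>s {#MF \<phi>#})"
    using assms unfolding right_semi_analytic_def by blast
  define f where "f = (\<lambda>(\<Pi>, prs :: ('c mform multiset \<times> 'c mform multiset) list). Grp \<Pi> None prs [])"
  let ?gs = "map f Gs"
  have ctx: "map gctx ?gs = map fst Gs"
    by (auto simp: f_def)
  have dc: "distinct (map gctx ?gs)" unfolding ctx using d by auto
  have "prems r = mset (concat (map grp_prems ?gs))"
    unfolding p by (simp add: f_def grp_prems_def case_prod_unfold comp_def)
  moreover have suc: "(\<Sum>g\<in>set ?gs. suc_items g) = {#}"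
    by (simp add: sum_eq_empty_iff f_def suc_items_def case_prod_unfold)
  moreover have "\<forall>g\<in>set ?gs. (\<forall>(\<psi>s, \<theta>s)\<in>set (side g). Vs \<psi>s \<union> Vs \<theta>s \<subseteq> Vs ({#} + {#\<phi>#})) \<and>
        (\<forall>\<phi>s\<in>set (main g). Vs \<phi>s \<subseteq> Vs ({#} + {#\<phi>#}))"
    using v by (fastforce simp: f_def)
  moreover have none: "\<forall>g\<in>set ?gs. gsuc g = None" by (auto simp: f_def)
  then have "\<forall>g\<in>set ?gs. \<forall>g'\<in>set ?gs. \<forall>d. gsuc g = Some d \<longrightarrow>
        d \<noteq> gctx g' \<and> (gsuc g' = Some d \<longrightarrow> g = g')" by simp
  moreover have ante: "mset (map (\<lambda>g. Ctx (gctx g)) ?gs) = mset (map (\<lambda>(\<Gamma>, prs). Ctx \<Gamma>) Gs)"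
    by (simp add: f_def case_prod_unfold multiset.map_comp comp_def)
  moreover have "concl r = (mset (map (\<lambda>g. Ctx (gctx g)) ?gs) + image_mset MF {#} \<Rightarrow>\<^sub>s
      (\<Sum>g\<in>set ?gs. suc_items g) + image_mset MF {#\<phi>#})"
    unfolding c suc ante by simp
  ultimately have "grouped r ?gs {#} {#\<phi>#}"
    using dc unfolding grouped_def by blast
  then show ?thesis using none by blast
qed

text \<open>Here a group may hold side and main premises together with a succedent, so nothing is
  claimed about their separation.\<close>

lemma context_sharing_semi_analytic_grouped:
  fixes r :: "'c rule"
  assumes "context_sharing_semi_analytic r"
  shows "\<exists>gs \<phi>. grouped r gs {#\<phi>#} {#}"
proof -
  obtain Gs :: "(nat \<times> nat \<times> ('c mform multiset \<times> 'c mform multiset) list \<times>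
        'c mform multiset list) list" and \<phi> where
    d: "distinct (map fst Gs @ map (fst \<circ> snd) Gs)" and
    v: "\<forall>(\<Gamma>, \<Delta>, prs, \<phi>ss)\<in>set Gs.
        (\<forall>(\<psi>s, \<theta>s)\<in>set prs. Vs \<psi>s \<union> Vs \<theta>s \<subseteq> V \<phi>) \<and> (\<forall>\<phi>s\<in>set \<phi>ss. Vs \<phi>s \<subseteq> V \<phi>)" and
    p: "prems r =
        mset (concat (map (\<lambda>(\<Gamma>, \<Delta>, prs, \<phi>ss). map (\<lambda>(\<psi>s, \<theta>s).
          add_mset (Ctx \<Gamma>) (image_mset MF \<psi>s) \<Rightarrow>\<^sub>s image_mset MF \<theta>s) prs) Gs)) +
        mset (concat (map (\<lambda>(\<Gamma>, \<Delta>, prs, \<phi>ss). map (\<lambda>\<phi>s.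
          add_mset (Ctx \<Gamma>) (image_mset MF \<phi>s) \<Rightarrow>\<^sub>s {#Ctx \<Delta>#}) \<phi>ss) Gs))" and
    c: "concl r = (mset (map (\<lambda>(\<Gamma>, \<Delta>, prs, \<phi>ss). Ctx \<Gamma>) Gs) + {#MF \<phi>#}
         \<Rightarrow>\<^sub>s mset (map (\<lambda>(\<Gamma>, \<Delta>, prs, \<phi>ss). Ctx \<Delta>) Gs))"
    using assms unfolding context_sharing_semi_analytic_def by blast
  define h where "h = (\<lambda>(\<Gamma>, \<Delta>, prs :: ('c mform multiset \<times> 'c mform multiset) list,
    \<phi>ss :: 'c mform multiset list). Grp \<Gamma> (Some \<Delta>) prs \<phi>ss)"
  have h: "gsuc (h x) = Some (fst (snd x))" "gctx (h x) = fst x" for x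
    by (simp_all add: h_def case_prod_unfold)
  let ?gs = "map h Gs"
  have ctx: "map gctx ?gs = map fst Gs"
    by (auto simp: h_def)
  have dc: "distinct (map gctx ?gs)" unfolding ctx using d by auto
  then have dg: "distinct ?gs" unfolding distinct_map by blast
  have "inj_on (fst \<circ> snd) (set Gs)" "(fst \<circ> snd) ` set Gs \<inter> fst ` set Gs = {}"
    using d by (auto simp: distinct_map)
  then have sep: "\<forall>x\<in>set Gs. \<forall>y\<in>set Gs. fst (snd x) \<noteq> fst y \<and> (fst (snd x) = fst (snd y) \<longrightarrow> x = y)"
    unfolding inj_on_def comp_def by blast
  have "prems r = mset (concat (map grp_prems ?gs))"
    unfolding p by (induction Gs) (auto simp: h_def grp_prems_def suc_items_def)
  moreover have suc: "(\<Sum>g\<in>set ?gs. suc_items g) = mset (map (\<lambda>(\<Gamma>, \<Delta>, prs, \<phi>ss). Ctx \<Delta>) Gs)"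
  proof -
    have "(\<Sum>g\<in>set ?gs. suc_items g) = (\<Sum>g\<leftarrow>?gs. suc_items g)"
      using dg by (rule sum.distinct_set_conv_list)
    also have "\<dots> = mset (map (\<lambda>(\<Gamma>, \<Delta>, prs, \<phi>ss). Ctx \<Delta>) Gs)"
      by (induction Gs) (auto simp: h_def suc_items_def)
    finally show ?thesis .
  qed
  moreover have "\<forall>g\<in>set ?gs. \<forall>g'\<in>set ?gs. \<forall>d. gsuc g = Some d \<longrightarrow>
        d \<noteq> gctx g' \<and> (gsuc g' = Some d \<longrightarrow> g = g')"
    using sep unfolding set_map by (simp add: h) metis
  moreover have "\<forall>g\<in>set ?gs. (\<forall>(\<psi>s, \<theta>s)\<in>set (side g). Vs \<psi>s \<union> Vs \<theta>s \<subseteq> Vs ({#\<phi>#} + {#})) \<and>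
        (\<forall>\<phi>s\<in>set (main g). Vs \<phi>s \<subseteq> Vs ({#\<phi>#} + {#}))"
    using v by (fastforce simp: h_def)
  moreover have ante: "mset (map (\<lambda>g. Ctx (gctx g)) ?gs) = mset (map (\<lambda>(\<Gamma>, \<Delta>, prs, \<phi>ss). Ctx \<Gamma>) Gs)"
    by (simp add: h_def case_prod_unfold multiset.map_comp comp_def)
  moreover have "concl r = (mset (map (\<lambda>g. Ctx (gctx g)) ?gs) + image_mset MF {#\<phi>#} \<Rightarrow>\<^sub>s
      (\<Sum>g\<in>set ?gs. suc_items g) + image_mset MF {#})"
    unfolding c suc ante by simp
  ultimately have "grouped r ?gs {#\<phi>#} {#}"
    using dc unfolding grouped_def by blast
  then show ?thesis by blast
qed

section \<open>From single rules to whole proofs\<close>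

context FLe_axiomatic_extension
begin

lemma interpolating_rule_semi_analytic:
  assumes "r \<in> R" and "semi_analytic r" and "modal_compatible R"
  shows "interpolating_rule r"
proof -
  consider "left_semi_analytic r" | "right_semi_analytic r" | "rule_K r" | "rule_D r" | "rule_RS4 r"
    using assms(2) by (auto simp: semi_analytic_def)
  then show ?thesis
  proof cases
    case 1
    then obtain gs \<phi> where "grouped r gs {#\<phi>#} {#}" "\<forall>g\<in>set gs. side g = [] \<or> gsuc g = None"
      using left_semi_analytic_grouped by blast
    then show ?thesis by (intro interpolating_rule_grouped[OF assms(1)]) auto
  next
    case 2
    then obtain gs \<phi> where "grouped r gs {#} {#\<phi>#}" "\<forall>g\<in>set gs. gsuc g = None"
      using right_semi_analytic_grouped by blast
    then show ?thesis by (intro interpolating_rule_grouped[OF assms(1)]) auto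
  qed (use assms in \<open>auto simp: modal_compatible_def
    intro: interpolating_rule_K interpolating_rule_D interpolating_rule_RS4\<close>)
qed

lemma interpolating_rule_context_sharing:
  assumes "r \<in> R" and "context_sharing_semi_analytic r"
    and "admissible L H left_weakening" "admissible L H context_sharing_left_imp"
  shows "interpolating_rule r"
  using context_sharing_semi_analytic_grouped[OF assms(2)] interpolating_rule_grouped[OF assms(1)]
    assms(3,4) by blast

lemma interpolation_step:
  assumes "interpolating_rule r" and "rule_instance L r (mset (map root ts)) (\<Sigma> + \<Lambda> \<Rightarrow>\<^sub>s \<Delta>)"
    and itp: "\<And>t \<Sigma> \<Lambda> \<Delta>. t \<in> set ts \<Longrightarrow> root t = (\<Sigma> + \<Lambda> \<Rightarrow>\<^sub>s \<Delta>) \<Longrightarrow>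
      \<exists>C. interpolant L H \<Sigma> \<Lambda> \<Delta> C \<and> w C \<le> b t"
  shows "\<exists>C. interpolant L H \<Sigma> \<Lambda> \<Delta> C \<and> w C \<le> (\<Sum>t\<leftarrow>ts. b t + 3) + 2 * size (\<Sigma> + \<Lambda>) + 3"
proof -
  \<comment> \<open>Different subproofs may prove the same premise; the cheapest one counts.\<close>
  define \<beta> where "\<beta> P = Min (b ` {t \<in> set ts. root t = P})" for P
  have le: "\<beta> (root t) \<le> b t" if "t \<in> set ts" for t
    using that by (auto simp: \<beta>_def)
  have "interpolable \<beta> (root t)" if "t \<in> set ts" for t
  proof -
    have "\<beta> (root t) \<in> b ` {t' \<in> set ts. root t' = root t}"
      unfolding \<beta>_def using that by (intro Min_in) auto
    then obtain t' where "t' \<in> set ts" "root t' = root t" "\<beta> (root t) = b t'" by auto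
    then show ?thesis unfolding interpolable_def using itp[of t'] by metis
  qed
  then have "\<forall>P\<in>#mset (map root ts). interpolable \<beta> P" by auto
  then obtain C where "interpolant L H \<Sigma> \<Lambda> \<Delta> C"
    "w C \<le> (\<Sum>P\<in>#mset (map root ts). \<beta> P + 3) + 2 * size (\<Sigma> + \<Lambda>) + 3"
    using assms(1,2) unfolding interpolating_rule_def by blast
  moreover have "(\<Sum>P\<in>#mset (map root ts). \<beta> P + 3) = (\<Sum>t\<leftarrow>ts. \<beta> (root t) + 3)"
    by (induction ts) auto
  moreover have "(\<Sum>t\<leftarrow>ts. \<beta> (root t) + 3) \<le> (\<Sum>t\<leftarrow>ts. b t + 3)"
    using le by (intro sum_list_mono) auto
  ultimately show ?thesis by (intro exI[of _ C]) linarith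
qed

text \<open>The assumption on \<open>b\<close> is the recurrence that one inference step produces.
  The leaves are whole \<open>G\<close>-proofs inside \<pi>, so the bound for \<open>G\<close>
  applies to them unchanged.\<close>

lemma interpolation_transfer:
  assumes rules: "\<forall>r\<in>R. interpolating_rule r"
    and b: "\<And>S ts. (\<Sum>t\<leftarrow>ts. b t + 3) + 2 * size (ante S) + 3 \<le> b (Node S ts)"
    and G: "\<And>\<pi> \<Sigma> \<Lambda> \<Delta>. \<pi> \<in> proofs L G \<Longrightarrow> root \<pi> = (\<Sigma> + \<Lambda> \<Rightarrow>\<^sub>s \<Delta>) \<Longrightarrow>
      \<exists>C. interpolant L H \<Sigma> \<Lambda> \<Delta> C \<and> w C \<le> b \<pi>"
    and \<pi>: "\<pi> \<in> proofs L H" "root \<pi> = (\<Sigma> + \<Lambda> \<Rightarrow>\<^sub>s \<Delta>)"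
  shows "\<exists>C. interpolant L H \<Sigma> \<Lambda> \<Delta> C \<and> w C \<le> b \<pi>"
proof -
  have "\<pi> \<in> derivs L (proofs L G) R" using \<pi>(1) by (simp add: H_eq)
  then show ?thesis using \<pi>(2)
  proof (induction arbitrary: \<Sigma> \<Lambda> \<Delta> rule: derivs.induct)
    case (base t)
    then show ?case by (rule G)
  next
    case (step r ts S)
    have "\<exists>C. interpolant L H \<Sigma> \<Lambda> \<Delta> C \<and> w C \<le> (\<Sum>t\<leftarrow>ts. b t + 3) + 2 * size (\<Sigma> + \<Lambda>) + 3"
      using step rules by (intro interpolation_step[of r]) auto
    then show ?case using b[of ts S] step.prems by force
  qed
qed

end

section \<open>Polynomial bounds\<close>

lemma form_length_pos: "form_length \<phi> \<ge> 1"
  by (cases \<phi>) auto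

text \<open>Every formula contributes at least 2, itself and its separator.\<close>

lemma size_ante_le_seq_length: "2 * size (ante S) + 1 \<le> seq_length S"
proof -
  have "2 * size M \<le> (\<Sum>\<phi>\<in>#M. Suc (form_length \<phi>))" for M :: "'c form multiset"
  proof (induction M)
    case (add \<phi> M)
    then show ?case using form_length_pos[of \<phi>] by simp
  qed simp
  from this[of "ante S"] show ?thesis by (simp add: seq_length_def)
qed

lemma proof_length_ge_2: "proof_length \<pi> \<ge> 2"
  by (cases \<pi>) (simp add: seq_length_def)

text \<open>Powers with positive exponent are superadditive on the naturals; exponent 0 would count
  the entries instead.\<close>

lemma sum_list_power_le:
  fixes xs :: "nat list"
  shows "(\<Sum>x\<leftarrow>xs. x ^ Suc k) \<le> sum_list xs ^ Suc k"
proof (induction xs)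
  case (Cons x xs)
  have "x ^ Suc k + sum_list xs ^ Suc k \<le> x * (x + sum_list xs) ^ k + sum_list xs * (x + sum_list xs) ^ k"
    by (auto intro!: add_mono mult_left_mono power_mono)
  also have "\<dots> = (x + sum_list xs) ^ Suc k" by (simp add: algebra_simps)
  finally show ?case using Cons.IH by simp
qed simp

text \<open>Think of \<open>x\<close> as the total length of the subproofs and of \<open>y\<close>
  as the node's own share. In the cube, \<open>x * (y * y)\<close> and \<open>y * (y * y)\<close>
  dominate \<open>4 * x\<close> and \<open>4 * y\<close>, which leaves room for the linear terms;
  higher exponents follow on multiplying by \<open>x + y\<close>.\<close>

lemma power_absorbs_linear:
  fixes x y :: nat
  assumes "y \<ge> 2"
  shows "x ^ (k + 3) + 2 * x + y + 2 \<le> (x + y) ^ (k + 3)"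
proof (induction k)
  case 0
  have "y * 4 \<le> y * (y * y)" "x * 4 \<le> x * (y * y)"
    using mult_mono[OF assms assms] by simp_all
  moreover have "(x + y) ^ 3 = x ^ 3 + 3 * (x * x * y) + 3 * (x * (y * y)) + y * (y * y)"
    by (simp add: power3_eq_cube algebra_simps)
  ultimately show ?case using assms unfolding add_0 by linarith
next
  case (Suc k)
  let ?d = "2 * x + y + 2"
  have "x ^ (Suc k + 3) + ?d \<le> x * (x ^ (k + 3) + ?d) + y * (x ^ (k + 3) + ?d)"
  proof -
    have "x ^ (Suc k + 3) \<le> x * (x ^ (k + 3) + ?d)"
      unfolding add_Suc power_Suc by (rule mult_le_mono2) simp
    moreover have "1 * ?d \<le> y * (x ^ (k + 3) + ?d)"
      by (rule mult_le_mono) (use assms in simp_all)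
    then have "?d \<le> y * (x ^ (k + 3) + ?d)" unfolding mult_1 .
    ultimately show ?thesis by (rule add_mono)
  qed
  also have "\<dots> = (x + y) * (x ^ (k + 3) + ?d)" by (simp add: algebra_simps)
  also have "\<dots> \<le> (x + y) * (x + y) ^ (k + 3)"
    using Suc.IH by (intro mult_left_mono) simp_all
  finally show ?case by (simp only: add_Suc power_Suc add.assoc)
qed

text \<open>Subproofs have length at least 2, so 3 per subproof costs at most twice their total
  length; the antecedent and the constant are covered by the length of the end sequent.\<close>

lemma proof_length_power_step:
  "(\<Sum>t\<leftarrow>ts. proof_length t ^ (k + 3) + 3) + 2 * size (ante S) + 3 \<le> proof_length (Node S ts) ^ (k + 3)"
proof -
  let ?x = "\<Sum>t\<leftarrow>ts. proof_length t" and ?y = "Suc (seq_length S)"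
  have "(\<Sum>t\<leftarrow>ts. proof_length t ^ (k + 3) + 3) =
      (\<Sum>t\<leftarrow>ts. proof_length t ^ (k + 3)) + 3 * length ts"
    by (induction ts) auto
  moreover have "(\<Sum>t\<leftarrow>ts. proof_length t ^ (k + 3)) \<le> ?x ^ (k + 3)"
    using sum_list_power_le[of "k + 2" "map proof_length ts"]
    by (simp add: comp_def numeral_eq_Suc)
  moreover have "2 * length ts \<le> ?x"
  proof (induction ts)
    case (Cons t ts)
    then show ?case using proof_length_ge_2[of t] by simp
  qed simp
  moreover have "2 * size (ante S) + 1 \<le> seq_length S" by (rule size_ante_le_seq_length)
  moreover have "?x ^ (k + 3) + 2 * ?x + ?y + 2 \<le> (?x + ?y) ^ (k + 3)"
    by (rule power_absorbs_linear) (simp add: seq_length_def)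
  moreover have "proof_length (Node S ts) ^ (k + 3) = (?x + ?y) ^ (k + 3)" by (simp add: add.commute)
  ultimately show ?thesis by linarith
qed

text \<open>\<open>rules\<close> is assumed for every \<open>w\<close> because the locale is
  interpreted once with the zero weight and once with \<open>form_length\<close>.\<close>

lemma has_interpolation_AxExt:
  assumes "calculus_in_lang L H" "extends_FLe L H" and H: "H = AxExt G R"
    and rules: "\<And>w r. FLe_axiomatic_extension L H w G R \<Longrightarrow> r \<in> R \<Longrightarrow>
      FLe_axiomatic_extension.interpolating_rule L H w r"
  shows "has_interpolation L G H \<Longrightarrow> has_interpolation L H H"
    and "has_feasible_interpolation L G H \<Longrightarrow> has_feasible_interpolation L H H"
proof -
  have loc: "FLe_axiomatic_extension L H w G R" if "w = form_length \<or> w = (\<lambda>_. 0)" for w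
    using assms that by unfold_locales auto
  show "has_interpolation L H H" if G: "has_interpolation L G H"
  proof -
    interpret FLe_axiomatic_extension L H "\<lambda>_. 0" G R by (rule loc) simp
    \<comment> \<open>For the zero weight the bound is void; it is written in this form only to fit
      the recurrence.\<close>
    have "\<exists>C. interpolant L H \<Sigma> \<Lambda> \<Delta> C \<and> 0 \<le> proof_length \<pi> ^ (0 + 3)"
      if \<pi>: "\<pi> \<in> proofs L H" "root \<pi> = (\<Sigma> + \<Lambda> \<Rightarrow>\<^sub>s \<Delta>)" for \<pi> \<Sigma> \<Lambda> \<Delta>
    proof (rule interpolation_transfer[OF _ proof_length_power_step _ \<pi>])
      show "\<forall>r\<in>R. interpolating_rule r" using rules[OF FLe_axiomatic_extension_axioms] by blast
    qed (use G in \<open>auto simp: has_interpolation_def\<close>)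
    then show ?thesis unfolding has_interpolation_def by blast
  qed
  show "has_feasible_interpolation L H H" if G: "has_feasible_interpolation L G H"
  proof -
    interpret FLe_axiomatic_extension L H form_length G R by (rule loc) simp
    obtain k where k: "\<And>\<pi> \<Sigma> \<Lambda> \<Delta>. \<pi> \<in> proofs L G \<Longrightarrow> root \<pi> = (\<Sigma> + \<Lambda> \<Rightarrow>\<^sub>s \<Delta>) \<Longrightarrow>
        \<exists>C. interpolant L H \<Sigma> \<Lambda> \<Delta> C \<and> form_length C \<le> proof_length \<pi> ^ k"
      using G unfolding has_feasible_interpolation_def by blast
    \<comment> \<open>Raising the exponent by 3 provides the cubic growth that the recurrence
      requires, at no cost since proofs have length at least 2.\<close>
    have mono: "proof_length \<pi> ^ k \<le> proof_length \<pi> ^ (k + 3)" for \<pi> :: "'a ptree"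
      using proof_length_ge_2[of \<pi>] by (intro power_increasing) auto
    have base: "\<exists>C. interpolant L H \<Sigma> \<Lambda> \<Delta> C \<and> form_length C \<le> proof_length \<pi> ^ (k + 3)"
      if \<pi>: "\<pi> \<in> proofs L G" "root \<pi> = (\<Sigma> + \<Lambda> \<Rightarrow>\<^sub>s \<Delta>)" for \<pi> \<Sigma> \<Lambda> \<Delta>
    proof -
      obtain C where "interpolant L H \<Sigma> \<Lambda> \<Delta> C" "form_length C \<le> proof_length \<pi> ^ k"
        using k[OF \<pi>] by blast
      then show ?thesis using mono[of \<pi>] by (intro exI[of _ C]) simp
    qed
    have "\<exists>C. interpolant L H \<Sigma> \<Lambda> \<Delta> C \<and> form_length C \<le> proof_length \<pi> ^ (k + 3)"
      if \<pi>: "\<pi> \<in> proofs L H" "root \<pi> = (\<Sigma> + \<Lambda> \<Rightarrow>\<^sub>s \<Delta>)" for \<pi> \<Sigma> \<Lambda> \<Delta>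
    proof (rule interpolation_transfer[OF _ proof_length_power_step _ \<pi>])
      show "\<forall>r\<in>R. interpolating_rule r" using rules[OF FLe_axiomatic_extension_axioms] by blast
    qed (rule base)
    then show ?thesis unfolding has_feasible_interpolation_def by (intro exI[of _ "k + 3"]) simp
  qed
qed

theorem theorem4p4:
  fixes L :: "'c conn set" and G H :: "'c calculus"
  assumes "calculus_in_lang L G" and "calculus_in_lang L H" and "extends_FLe L H"
  shows
    "(\<forall>R. H = AxExt G R \<longrightarrow>
        (\<forall>r\<in>R. semi_analytic r \<or> rule_4 r \<or> rule_4D r) \<longrightarrow>
        modal_compatible R \<longrightarrow>
        ((\<exists>r\<in>R. rule_4 r \<or> rule_4D r) \<longrightarrow> admissible L H left_weakening_boxed) \<longrightarrow>
        (has_interpolation L G H \<longrightarrow> has_interpolation L H H) \<and>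
        (has_feasible_interpolation L G H \<longrightarrow> has_feasible_interpolation L H H)) \<and>
     (\<forall>R. H = AxExt G R \<longrightarrow>
        (\<forall>r\<in>R. semi_analytic r \<or> context_sharing_semi_analytic r) \<longrightarrow>
        modal_compatible R \<longrightarrow>
        admissible L H left_weakening \<longrightarrow>
        admissible L H right_weakening \<longrightarrow>
        admissible L H context_sharing_left_imp \<longrightarrow>
        (has_interpolation L G H \<longrightarrow> has_interpolation L H H) \<and>
        (has_feasible_interpolation L G H \<longrightarrow> has_feasible_interpolation L H H))"
proof (intro conjI allI impI)
  fix R
  assume H: "H = AxExt G R" and R: "\<forall>r\<in>R. semi_analytic r \<or> rule_4 r \<or> rule_4D r"
    and mc: "modal_compatible R"
    and weak: "(\<exists>r\<in>R. rule_4 r \<or> rule_4D r) \<longrightarrow> admissible L H left_weakening_boxed"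
  have rules: "FLe_axiomatic_extension.interpolating_rule L H w r"
    if loc: "FLe_axiomatic_extension L H w G R" and r: "r \<in> R" for w r
  proof -
    interpret FLe_axiomatic_extension L H w G R by (rule loc)
    consider "semi_analytic r" | "rule_4 r" | "rule_4D r" using R r by blast
    then show ?thesis
    proof cases
      case 3
      then obtain k where "k \<in> R" "rule_4 k" using mc r by (auto simp: modal_compatible_def)
      then show ?thesis using 3 weak r interpolating_rule_4D by blast
    qed (use interpolating_rule_semi_analytic interpolating_rule_4 mc weak r in blast)+
  qed
  show "has_interpolation L H H" if "has_interpolation L G H"
    by (rule has_interpolation_AxExt(1)[OF assms(2,3) H]) (fact rules, fact that)
  show "has_feasible_interpolation L H H" if "has_feasible_interpolation L G H"
    by (rule has_interpolation_AxExt(2)[OF assms(2,3) H]) (fact rules, fact that)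
next
  fix R
  assume H: "H = AxExt G R" and R: "\<forall>r\<in>R. semi_analytic r \<or> context_sharing_semi_analytic r"
    and mc: "modal_compatible R"
    and weak: "admissible L H left_weakening" "admissible L H context_sharing_left_imp"
  have rules: "FLe_axiomatic_extension.interpolating_rule L H w r"
    if loc: "FLe_axiomatic_extension L H w G R" and r: "r \<in> R" for w r
  proof -
    interpret FLe_axiomatic_extension L H w G R by (rule loc)
    show ?thesis
      using R r mc weak interpolating_rule_semi_analytic interpolating_rule_context_sharing
      by blast
  qed
  show "has_interpolation L H H" if "has_interpolation L G H"
    by (rule has_interpolation_AxExt(1)[OF assms(2,3) H]) (fact rules, fact that)
  show "has_feasible_interpolation L H H" if "has_feasible_interpolation L G H"
    by (rule has_interpolation_AxExt(2)[OF assms(2,3) H]) (fact rules, fact that)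
qed

end
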